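(* Let $A = B \times H$ be a biproduct over a field $k$. The assignment $f \mapsto F$, where $F(b \times h) = f(b) \times h$ for all $b \in B$ and $h \in H$, gives an isomorphism of monoids $\mathrm{End}_{\mathcal{YD}-\mathrm{Hopf}}(B) \simeq \mathrm{End}_{\mathrm{Hopf}}(A, \pi, j)$ and an isomorphism of groups $\mathrm{Aut}_{\mathcal{YD}-\mathrm{Hopf}}(B) \simeq \mathrm{Aut}_{\mathrm{Hopf}}(A, \pi, j)$.
   Context: Let $k$ be a field and $H$ a Hopf algebra over $k$. Sweedler notation: $\Delta(c) = c_{(1)} \otimes c_{(2)}$; for a left $H$-comodule $(M,\rho)$, $\rho(m) = m_{(-1)} \otimes m_{(0)} \in H \otimes M$. Biproduct. $B$ is a vector space which is an algebra, a coalgebra, a left $H$-module and a left $H$-comodule over $k$, such that: $B$ is a left $H$-module algebra ($h\cdot 1 = \epsilon(h)1$, $h\cdot(bb') = (h_{(1)}\cdot b)(h_{(2)}\cdot b')$); a left $H$-module coalgebra ($\epsilon(h\cdot b) = \epsilon(h)\epsilon(b)$, $\Delta(h\cdot b) = h_{(1)}\cdot b_{(1)} \otimes h_{(2)}\cdot b_{(2)}$); a left $H$-comodule algebra ($\rho(1) = 1\otimes 1$, $\rho(bb') = b_{(-1)}b'_{(-1)} \otimes b_{(0)}b'_{(0)}$); a left $H$-comodule coalgebra ($b_{(-1)}\epsilon(b_{(0)}) = \epsilon(b)1$, $b_{(1)(-1)}b_{(2)(-1)} \otimes b_{(1)(0)} \otimes b_{(2)(0)} = b_{(-1)} \otimes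 b_{(0)(1)} \otimes b_{(0)(2)}$); $\epsilon : B \to k$ is an algebra map and $\Delta(1) = 1 \otimes 1$; $\Delta(bb') = b_{(1)}(b_{(2)(-1)}\cdot b'_{(1)}) \otimes b_{(2)(0)}b'_{(2)}$; $h_{(1)}b_{(-1)} \otimes h_{(2)}\cdot b_{(0)} = (h_{(1)}\cdot b)_{(-1)}h_{(2)} \otimes (h_{(1)}\cdot b)_{(0)}$; and $\mathrm{Id}_B$ has a convolution inverse. (Equivalently, $B$ is a Hopf algebra in the Yetter-Drinfel'd category ${}_H^H\mathcal{YD}$.) The biproduct $A = B \times H$ is the Hopf algebra over $k$ with underlying space $B \otimes H$ (tensors written $b \times h$), product $(b \times h)(b' \times h') = b(h_{(1)}\cdot b') \times h_{(2)}h'$, unit $1 \times 1$, coproduct $\Delta(b \times h) = (b_{(1)} \times b_{(2)(-1)}h_{(1)}) \otimes (b_{(2)(0)} \times h_{(2)})$ and counit $\epsilon \otimes \epsilon$. Maps: $\pi : A \to H$, $\pi(b \times h) = \epsilon(b)h$, and $j : H \to A$, $j(h) = 1 \times h$, are Hopf algebra maps with $\pi \circ j = \mathrm{Id}_H$. $\mathrm{End}_{\mathrm{Hopf}}(A, \pi, j)$ is the monoid (under composition) of Hopf algebra endomorphisms $F$ of $A$ with $\pi \circ F = \pi$ and $F \circ j = j$; $\mathrm{Aut}_{\mathrm{Hopf}}(A, \pi, j)$ is the group of Hopf algebra automorphisms of $A$ satisfying the same two conditions. $\mathrm{End}_{\mathcal{YD}-\mathrm{Hopf}}(B)$ is the monoid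 of linear endomorphisms of $B$ which are algebra maps, coalgebra maps, left $H$-module maps and left $H$-comodule maps; $\mathrm{Aut}_{\mathcal{YD}-\mathrm{Hopf}}(B)$ is its group of units. *)

theory Defs
  imports HOL.Hull "HOL-Algebra.AbelCoset" "HOL-Algebra.Module" "HOL-Algebra.RingHom"
begin

text \<open>
  Vector spaces over \<open>K\<close> are \<open>K\<close>-modules in the sense of \<^locale>\<open>module\<close>, with explicit carriers.
  When a \<^typ>\<open>('k, 'v) module\<close> is only a vector space, its \<^const>\<open>mult\<close> and \<^const>\<open>one\<close> fields
  are \<^const>\<open>undefined\<close> and play no role.
\<close>

definition linear_map ::
    "('k, 'q) ring_scheme \<Rightarrow> ('k, 'v, 'm) module_scheme \<Rightarrow> ('k, 'w, 'n) module_scheme \<Rightarrow> ('v \<Rightarrow> 'w) \<Rightarrow> bool"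
  where "linear_map K V W f \<longleftrightarrow>
    f \<in> carrier V \<rightarrow> carrier W \<and>
    (\<forall>x\<in>carrier V. \<forall>y\<in>carrier V. f (x \<oplus>\<^bsub>V\<^esub> y) = f x \<oplus>\<^bsub>W\<^esub> f y) \<and>
    (\<forall>c\<in>carrier K. \<forall>x\<in>carrier V. f (c \<odot>\<^bsub>V\<^esub> x) = c \<odot>\<^bsub>W\<^esub> f x)"

definition bilinear_map ::
    "('k, 'q) ring_scheme \<Rightarrow> ('k, 'u, 'l) module_scheme \<Rightarrow> ('k, 'v, 'm) module_scheme \<Rightarrow>
     ('k, 'w, 'n) module_scheme \<Rightarrow> ('u \<Rightarrow> 'v \<Rightarrow> 'w) \<Rightarrow> bool"
  where "bilinear_map K U V W \<beta> \<longleftrightarrow>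
    (\<forall>u\<in>carrier U. linear_map K V W (\<beta> u)) \<and>
    (\<forall>v\<in>carrier V. linear_map K U W (\<lambda>u. \<beta> u v))"

definition field_as_module :: "('k, 'q) ring_scheme \<Rightarrow> ('k, 'k) module"
  where "field_as_module K =
    \<lparr>carrier = carrier K, mult = mult K, one = one K, zero = zero K, add = add K, smult = mult K\<rparr>"


section \<open>Tensor products\<close>

definition free_module :: "('k, 'q) ring_scheme \<Rightarrow> 'x set \<Rightarrow> ('k, 'x \<Rightarrow> 'k) module"
  where "free_module K X =
    \<lparr>carrier = {r. finite {x. r x \<noteq> \<zero>\<^bsub>K\<^esub>} \<and> {x. r x \<noteq> \<zero>\<^bsub>K\<^esub>} \<subseteq> X \<and> range r \<subseteq> carrier K},
     mult = undefined, one = undefined,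
     zero = (\<lambda>x. \<zero>\<^bsub>K\<^esub>),
     add = (\<lambda>r s x. r x \<oplus>\<^bsub>K\<^esub> s x),
     smult = (\<lambda>c r x. c \<otimes>\<^bsub>K\<^esub> r x)\<rparr>"

definition free_gen :: "('k, 'q) ring_scheme \<Rightarrow> 'x \<Rightarrow> 'x \<Rightarrow> 'k"
  where "free_gen K x = (\<lambda>y. if y = x then \<one>\<^bsub>K\<^esub> else \<zero>\<^bsub>K\<^esub>)"

text \<open>
  Scaling a coset pointwise yields a coset only for nonzero scalars, hence the union in the
  scalar multiplication below.
\<close>

definition quotient_module :: "('k, 'v, 'm) module_scheme \<Rightarrow> 'v set \<Rightarrow> ('k, 'v set) module"
  where "quotient_module M N =
    \<lparr>carrier = a_rcosets\<^bsub>M\<^esub> N,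
     mult = undefined, one = undefined,
     zero = N,
     add = set_add M,
     smult = (\<lambda>c S. \<Union>x\<in>S. N +>\<^bsub>M\<^esub> (c \<odot>\<^bsub>M\<^esub> x))\<rparr>"

type_synonym ('k, 'v, 'w) tensor = "('v \<times> 'w \<Rightarrow> 'k) set"

definition tensor_generators ::
    "('k, 'q) ring_scheme \<Rightarrow> ('k, 'v, 'm) module_scheme \<Rightarrow> ('k, 'w, 'n) module_scheme \<Rightarrow> ('v \<times> 'w \<Rightarrow> 'k) set"
  where "tensor_generators K V W =
    (let F = free_module K (carrier V \<times> carrier W); \<delta> = (\<lambda>v w. free_gen K (v, w)) in
      {\<delta> (v \<oplus>\<^bsub>V\<^esub> v') w \<ominus>\<^bsub>F\<^esub> (\<delta> v w \<oplus>\<^bsub>F\<^esub> \<delta> v' w) | v v' w. v \<in> carrier V \<and> v' \<in> carrier V \<and> w \<in> carrier W} \<union>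
      {\<delta> v (w \<oplus>\<^bsub>W\<^esub> w') \<ominus>\<^bsub>F\<^esub> (\<delta> v w \<oplus>\<^bsub>F\<^esub> \<delta> v w') | v w w'. v \<in> carrier V \<and> w \<in> carrier W \<and> w' \<in> carrier W} \<union>
      {\<delta> (c \<odot>\<^bsub>V\<^esub> v) w \<ominus>\<^bsub>F\<^esub> c \<odot>\<^bsub>F\<^esub> \<delta> v w | c v w. c \<in> carrier K \<and> v \<in> carrier V \<and> w \<in> carrier W} \<union>
      {\<delta> v (c \<odot>\<^bsub>W\<^esub> w) \<ominus>\<^bsub>F\<^esub> c \<odot>\<^bsub>F\<^esub> \<delta> v w | c v w. c \<in> carrier K \<and> v \<in> carrier V \<and> w \<in> carrier W})"

definition tensor_relations ::
    "('k, 'q) ring_scheme \<Rightarrow> ('k, 'v, 'm) module_scheme \<Rightarrow> ('k, 'w, 'n) module_scheme \<Rightarrow> ('v \<times> 'w \<Rightarrow> 'k) set"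
  where "tensor_relations K V W =
    (\<lambda>N. submodule N K (free_module K (carrier V \<times> carrier W))) hull tensor_generators K V W"

definition tensor_space ::
    "('k, 'q) ring_scheme \<Rightarrow> ('k, 'v, 'm) module_scheme \<Rightarrow> ('k, 'w, 'n) module_scheme \<Rightarrow>
     ('k, ('k, 'v, 'w) tensor) module"
  where "tensor_space K V W =
    quotient_module (free_module K (carrier V \<times> carrier W)) (tensor_relations K V W)"

definition tens ::
    "('k, 'q) ring_scheme \<Rightarrow> ('k, 'v, 'm) module_scheme \<Rightarrow> ('k, 'w, 'n) module_scheme \<Rightarrow>
     'v \<Rightarrow> 'w \<Rightarrow> ('k, 'v, 'w) tensor"
  where "tens K V W v w =
    tensor_relations K V W +>\<^bsub>free_module K (carrier V \<times> carrier W)\<^esub> free_gen K (v, w)"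

text \<open>
  Sweedler notation: if \<open>t\<close> is the sum of the \<open>c\<^sub>i (v\<^sub>i \<otimes> w\<^sub>i)\<close>, then \<open>sweedler K U t \<beta>\<close> is the sum
  of the \<open>c\<^sub>i \<beta>(v\<^sub>i, w\<^sub>i)\<close> in \<open>U\<close>; it does not depend on the representation of \<open>t\<close> when \<open>\<beta>\<close> is
  bilinear on the carriers (facts \<open>sweedler_tens\<close> and \<open>linear_map_sweedler\<close> below). Thus
  \<open>sweedler K U (\<Delta> c) (\<lambda>c1 c2. \<beta> c1 c2)\<close> is \<open>\<beta>(c\<^sub>(\<^sub>1\<^sub>), c\<^sub>(\<^sub>2\<^sub>))\<close>.
\<close>

definition sweedler ::
    "('k, 'q) ring_scheme \<Rightarrow> ('k, 'u, 'l) module_scheme \<Rightarrow> ('k, 'v, 'w) tensor \<Rightarrow> ('v \<Rightarrow> 'w \<Rightarrow> 'u) \<Rightarrow> 'u"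
  where "sweedler K U t \<beta> =
    (let r = (SOME r. r \<in> t) in
      \<Oplus>\<^bsub>U\<^esub>p \<in> {p. r p \<noteq> \<zero>\<^bsub>K\<^esub>}. r p \<odot>\<^bsub>U\<^esub> \<beta> (fst p) (snd p))"


subsection \<open>Well-definedness and universal property\<close>

lemma free_module_simps:
  "r \<in> carrier (free_module K X) \<longleftrightarrow>
     finite {x. r x \<noteq> \<zero>\<^bsub>K\<^esub>} \<and> {x. r x \<noteq> \<zero>\<^bsub>K\<^esub>} \<subseteq> X \<and> (\<forall>x. r x \<in> carrier K)"
  "\<zero>\<^bsub>free_module K X\<^esub> = (\<lambda>x. \<zero>\<^bsub>K\<^esub>)"
  "r \<oplus>\<^bsub>free_module K X\<^esub> s = (\<lambda>x. r x \<oplus>\<^bsub>K\<^esub> s x)"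
  "c \<odot>\<^bsub>free_module K X\<^esub> r = (\<lambda>x. c \<otimes>\<^bsub>K\<^esub> r x)"
  by (auto simp: free_module_def)

lemma free_gen_closed: "cring K \<Longrightarrow> x \<in> X \<Longrightarrow> free_gen K x \<in> carrier (free_module K X)"
proof -
  assume "cring K" "x \<in> X"
  interpret cring K by fact
  have "{y. free_gen K x y \<noteq> \<zero>\<^bsub>K\<^esub>} \<subseteq> {x}" by (auto simp: free_gen_def)
  then show ?thesis using \<open>x \<in> X\<close> finite_subset by (fastforce simp: free_module_simps free_gen_def)
qed

lemma free_module_module:
  assumes "cring K" shows "module K (free_module K X)"
proof -
  interpret cring K by fact
  let ?F = "free_module K X"
  have add: "(\<lambda>x. r x \<oplus>\<^bsub>K\<^esub> s x) \<in> carrier ?F" if "r \<in> carrier ?F" "s \<in> carrier ?F" for r s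
  proof -
    have "{x. r x \<oplus>\<^bsub>K\<^esub> s x \<noteq> \<zero>\<^bsub>K\<^esub>} \<subseteq> {x. r x \<noteq> \<zero>\<^bsub>K\<^esub>} \<union> {x. s x \<noteq> \<zero>\<^bsub>K\<^esub>}"
      by auto
    then show ?thesis using that unfolding free_module_simps
      by (meson add.m_closed finite_Un finite_subset le_sup_iff subset_trans)
  qed
  have scal: "(\<lambda>x. c \<otimes>\<^bsub>K\<^esub> r x) \<in> carrier ?F" if "c \<in> carrier K" "r \<in> carrier ?F" for c r
  proof -
    have "{x. c \<otimes>\<^bsub>K\<^esub> r x \<noteq> \<zero>\<^bsub>K\<^esub>} \<subseteq> {x. r x \<noteq> \<zero>\<^bsub>K\<^esub>}"
      using that by auto
    then show ?thesis using that unfolding free_module_simps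
      by (meson finite_subset subset_trans m_closed)
  qed
  have ab: "abelian_group ?F"
  proof (rule abelian_groupI)
    fix r assume r: "r \<in> carrier ?F"
    have "(\<lambda>x. (\<ominus>\<^bsub>K\<^esub> \<one>\<^bsub>K\<^esub>) \<otimes>\<^bsub>K\<^esub> r x) \<in> carrier ?F" using scal r by simp
    moreover have "(\<lambda>x. (\<ominus>\<^bsub>K\<^esub> \<one>\<^bsub>K\<^esub>) \<otimes>\<^bsub>K\<^esub> r x) \<oplus>\<^bsub>?F\<^esub> r = \<zero>\<^bsub>?F\<^esub>"
      using r by (auto simp: free_module_simps l_minus l_neg)
    ultimately show "\<exists>y\<in>carrier ?F. y \<oplus>\<^bsub>?F\<^esub> r = \<zero>\<^bsub>?F\<^esub>" by blast
  qed (use add in \<open>auto simp: free_module_simps a_assoc a_comm add.m_lcomm\<close>)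
  show ?thesis
    by (rule moduleI)
       (use ab assms scal in \<open>auto simp: free_module_simps l_distr r_distr m_assoc\<close>)
qed

lemma tensor_relations_submodule:
  assumes "module K V" "module K W"
  shows "submodule (tensor_relations K V W) K (free_module K (carrier V \<times> carrier W))"
proof -
  interpret V: module K V by fact
  interpret W: module K W by fact
  let ?X = "carrier V \<times> carrier W"
  let ?F = "free_module K ?X"
  interpret F: module K ?F by (rule free_module_module) unfold_locales
  have g: "tensor_generators K V W \<subseteq> carrier ?F"
    unfolding tensor_generators_def Let_def
    by (auto intro!: F.M.minus_closed F.M.add.m_closed F.smult_closed free_gen_closed V.is_cring)
  let ?S = "{N. submodule N K ?F \<and> tensor_generators K V W \<subseteq> N}"
  have c: "carrier ?F \<in> ?S" using F.carrier_is_submodule g by auto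
  show ?thesis unfolding tensor_relations_def hull_def
  proof (rule F.submoduleI)
    show "\<Inter> ?S \<subseteq> carrier ?F" using c by blast
    show "\<zero>\<^bsub>?F\<^esub> \<in> \<Inter> ?S"
      using subgroup.one_closed submodule.axioms(1) by fastforce
  next
    fix a b assume "a \<in> \<Inter> ?S" "b \<in> \<Inter> ?S"
    then show "a \<oplus>\<^bsub>?F\<^esub> b \<in> \<Inter> ?S" using F.submoduleE(5) by blast
  next
    fix a assume "a \<in> \<Inter> ?S"
    then show "\<ominus>\<^bsub>?F\<^esub> a \<in> \<Inter> ?S" using F.submoduleE(3) by blast
  next
    fix a x assume "a \<in> carrier K" "x \<in> \<Inter> ?S"
    then show "a \<odot>\<^bsub>?F\<^esub> x \<in> \<Inter> ?S" using F.submoduleE(4) by blast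
  qed
qed

lemma quotient_module_module:
  assumes "module K M" "submodule N K M"
  shows "module K (quotient_module M N)"
    and "\<And>x c. x \<in> carrier M \<Longrightarrow> c \<in> carrier K \<Longrightarrow>
        c \<odot>\<^bsub>quotient_module M N\<^esub> (N +>\<^bsub>M\<^esub> x) = N +>\<^bsub>M\<^esub> (c \<odot>\<^bsub>M\<^esub> x)"
proof -
  interpret M: module K M by fact
  interpret N: submodule N K M by fact
  interpret A: abelian_subgroup N M
    by (intro abelian_subgroupI3 additive_subgroup.intro M.M.abelian_group_axioms N.subgroup_axioms)
  let ?Q = "quotient_module M N"
  have car: "carrier ?Q = {N +>\<^bsub>M\<^esub> x |x. x \<in> carrier M}"
    by (auto simp: quotient_module_def A_RCOSETS_def')
  have plus: "(N +>\<^bsub>M\<^esub> x) \<oplus>\<^bsub>?Q\<^esub> (N +>\<^bsub>M\<^esub> y) = N +>\<^bsub>M\<^esub> (x \<oplus>\<^bsub>M\<^esub> y)"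
    if "x \<in> carrier M" "y \<in> carrier M" for x y
    using that by (simp add: quotient_module_def A.a_rcos_sum)
  show sm: "c \<odot>\<^bsub>?Q\<^esub> (N +>\<^bsub>M\<^esub> x) = N +>\<^bsub>M\<^esub> (c \<odot>\<^bsub>M\<^esub> x)" if "x \<in> carrier M" "c \<in> carrier K" for x c
  proof -
    have "N +>\<^bsub>M\<^esub> (c \<odot>\<^bsub>M\<^esub> y) = N +>\<^bsub>M\<^esub> (c \<odot>\<^bsub>M\<^esub> x)" if y: "y \<in> N +>\<^bsub>M\<^esub> x" for y
    proof -
      obtain n where n: "n \<in> N" "y = n \<oplus>\<^bsub>M\<^esub> x" using y by (auto simp: a_r_coset_def')
      have nM: "n \<in> carrier M" using n N.subset by auto
      have "c \<odot>\<^bsub>M\<^esub> y = c \<odot>\<^bsub>M\<^esub> n \<oplus>\<^bsub>M\<^esub> c \<odot>\<^bsub>M\<^esub> x"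
        using n nM that M.smult_r_distr \<open>x \<in> carrier M\<close> \<open>c \<in> carrier K\<close> by auto
      moreover have "c \<odot>\<^bsub>M\<^esub> n \<in> N" using n \<open>c \<in> carrier K\<close> by auto
      ultimately have "c \<odot>\<^bsub>M\<^esub> y \<in> N +>\<^bsub>M\<^esub> (c \<odot>\<^bsub>M\<^esub> x)" by (auto simp: a_r_coset_def')
      then show ?thesis
by (rule M.M.a_repr_independence[OF _ M.smult_closed N.subgroup_axioms, symmetric]) fact+
    qed
    moreover have "x \<in> N +>\<^bsub>M\<^esub> x" using A.a_rcos_self that by auto
    ultimately have "(\<Union>y\<in>N +>\<^bsub>M\<^esub> x. N +>\<^bsub>M\<^esub> (c \<odot>\<^bsub>M\<^esub> y)) = N +>\<^bsub>M\<^esub> (c \<odot>\<^bsub>M\<^esub> x)" by blast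
    then show ?thesis by (simp add: quotient_module_def)
  qed
  have z: "\<zero>\<^bsub>?Q\<^esub> = N +>\<^bsub>M\<^esub> \<zero>\<^bsub>M\<^esub>"
    using A.a_subset by (simp add: quotient_module_def)
  have ab: "abelian_group ?Q"
  proof (rule abelian_groupI)
    fix S assume "S \<in> carrier ?Q"
    then obtain x where x: "x \<in> carrier M" "S = N +>\<^bsub>M\<^esub> x" by (auto simp: car)
    then have "(N +>\<^bsub>M\<^esub> (\<ominus>\<^bsub>M\<^esub> x)) \<oplus>\<^bsub>?Q\<^esub> S = \<zero>\<^bsub>?Q\<^esub>" by (simp add: plus z M.M.l_neg)
    then show "\<exists>y\<in>carrier ?Q. y \<oplus>\<^bsub>?Q\<^esub> S = \<zero>\<^bsub>?Q\<^esub>"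
      using x(1) M.M.a_inv_closed unfolding car by blast
  next
    fix S T U assume "S \<in> carrier ?Q" "T \<in> carrier ?Q" "U \<in> carrier ?Q"
    then show "S \<oplus>\<^bsub>?Q\<^esub> T \<oplus>\<^bsub>?Q\<^esub> U = S \<oplus>\<^bsub>?Q\<^esub> (T \<oplus>\<^bsub>?Q\<^esub> U)"
      unfolding car by (elim CollectE exE conjE) (simp add: plus M.M.a_assoc)
  next
    fix S T assume "S \<in> carrier ?Q" "T \<in> carrier ?Q"
    then show "S \<oplus>\<^bsub>?Q\<^esub> T = T \<oplus>\<^bsub>?Q\<^esub> S"
      unfolding car by (elim CollectE exE conjE) (simp add: plus M.M.a_comm)
  next
    fix S T assume "S \<in> carrier ?Q" "T \<in> carrier ?Q"
    then show "S \<oplus>\<^bsub>?Q\<^esub> T \<in> carrier ?Q"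
      unfolding car by (elim CollectE exE conjE) (auto simp: plus)
  next
    show "\<zero>\<^bsub>?Q\<^esub> \<in> carrier ?Q" unfolding car z by blast
  next
    fix S assume "S \<in> carrier ?Q"
    then show "\<zero>\<^bsub>?Q\<^esub> \<oplus>\<^bsub>?Q\<^esub> S = S"
      unfolding car z by (elim CollectE exE conjE) (simp add: plus)
  qed
  show "module K ?Q"
  proof (rule moduleI)
    fix a S assume "a \<in> carrier K" "S \<in> carrier ?Q"
    then show "a \<odot>\<^bsub>?Q\<^esub> S \<in> carrier ?Q"
      unfolding car by (elim CollectE exE conjE) (auto simp: sm)
  next
    fix a b S assume "a \<in> carrier K" "b \<in> carrier K" "S \<in> carrier ?Q"
    then show "(a \<oplus>\<^bsub>K\<^esub> b) \<odot>\<^bsub>?Q\<^esub> S = a \<odot>\<^bsub>?Q\<^esub> S \<oplus>\<^bsub>?Q\<^esub> b \<odot>\<^bsub>?Q\<^esub> S"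
      unfolding car by (elim CollectE exE conjE) (simp add: plus sm M.smult_l_distr)
  next
    fix a S T assume "a \<in> carrier K" "S \<in> carrier ?Q" "T \<in> carrier ?Q"
    then show "a \<odot>\<^bsub>?Q\<^esub> (S \<oplus>\<^bsub>?Q\<^esub> T) = a \<odot>\<^bsub>?Q\<^esub> S \<oplus>\<^bsub>?Q\<^esub> a \<odot>\<^bsub>?Q\<^esub> T"
      unfolding car by (elim CollectE exE conjE) (simp add: plus sm M.smult_r_distr)
  next
    fix a b S assume "a \<in> carrier K" "b \<in> carrier K" "S \<in> carrier ?Q"
    then show "(a \<otimes>\<^bsub>K\<^esub> b) \<odot>\<^bsub>?Q\<^esub> S = a \<odot>\<^bsub>?Q\<^esub> (b \<odot>\<^bsub>?Q\<^esub> S)"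
      unfolding car by (elim CollectE exE conjE) (simp add: sm M.smult_assoc1)
  next
    fix S assume "S \<in> carrier ?Q"
    then show "\<one>\<^bsub>K\<^esub> \<odot>\<^bsub>?Q\<^esub> S = S"
      unfolding car by (elim CollectE exE conjE) (simp add: sm)
  qed (use ab M.R.is_cring in auto)
qed

lemma tensor_space_module:
  assumes "module K V" "module K W"
  shows "module K (tensor_space K V W)"
  unfolding tensor_space_def
  by (intro quotient_module_module free_module_module tensor_relations_submodule assms)
     (rule module.axioms(1)[OF assms(1)])

lemma tens_carrier:
  assumes "module K V" "module K W" "v \<in> carrier V" "w \<in> carrier W"
  shows "tens K V W v w \<in> carrier (tensor_space K V W)"
  using free_gen_closed[OF module.axioms(1)[OF assms(1)], of "(v,w)" "carrier V \<times> carrier W"] assms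
  by (auto simp: tens_def tensor_space_def quotient_module_def A_RCOSETS_def')

definition lin_ext where
  "lin_ext K U r \<phi> = (\<Oplus>\<^bsub>U\<^esub>p \<in> {p. r p \<noteq> \<zero>\<^bsub>K\<^esub>}. r p \<odot>\<^bsub>U\<^esub> \<phi> p)"

lemma lin_ext_superset:
  assumes "module K U" "r \<in> carrier (free_module K X)" "\<phi> \<in> X \<rightarrow> carrier U"
    "finite S" "{p. r p \<noteq> \<zero>\<^bsub>K\<^esub>} \<subseteq> S" "S \<subseteq> X"
  shows "lin_ext K U r \<phi> = (\<Oplus>\<^bsub>U\<^esub>p \<in> S. r p \<odot>\<^bsub>U\<^esub> \<phi> p)"
proof -
  interpret U: module K U by fact
  have phi: "\<phi> x \<in> carrier U" if "x \<in> X" for x using that assms(3) by auto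
  show ?thesis unfolding lin_ext_def
    apply (rule U.M.add.finprod_mono_neutral_cong_left)
    using assms(2,4-6) phi by (auto simp: free_module_simps Pi_def subset_iff)
qed

lemma lin_ext_linear:
  assumes "module K U" "\<phi> \<in> X \<rightarrow> carrier U"
  shows "linear_map K (free_module K X) U (\<lambda>r. lin_ext K U r \<phi>)"
proof -
  interpret U: module K U by fact
  interpret F: module K "free_module K X" by (rule free_module_module) unfold_locales
  note L = lin_ext_superset[OF assms(1) _ assms(2)]
  let ?F = "free_module K X"
  have cl: "lin_ext K U r \<phi> \<in> carrier U" if "r \<in> carrier ?F" for r
    unfolding lin_ext_def using that assms(2)
    by (intro U.M.finsum_closed) (auto simp: free_module_simps)
  have ad: "lin_ext K U (r \<oplus>\<^bsub>?F\<^esub> s) \<phi> = lin_ext K U r \<phi> \<oplus>\<^bsub>U\<^esub> lin_ext K U s \<phi>"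
    if r: "r \<in> carrier ?F" and s: "s \<in> carrier ?F" for r s
  proof -
    let ?S = "{p. r p \<noteq> \<zero>\<^bsub>K\<^esub>} \<union> {p. s p \<noteq> \<zero>\<^bsub>K\<^esub>}"
    have rs: "r \<oplus>\<^bsub>?F\<^esub> s \<in> carrier ?F" using r s by simp
    have S: "finite ?S" "?S \<subseteq> X" using r s by (auto simp: free_module_simps)
    have "lin_ext K U (r \<oplus>\<^bsub>?F\<^esub> s) \<phi> = (\<Oplus>\<^bsub>U\<^esub>p \<in> ?S. (r p \<oplus>\<^bsub>K\<^esub> s p) \<odot>\<^bsub>U\<^esub> \<phi> p)"
    proof -
      have "{p. (r \<oplus>\<^bsub>?F\<^esub> s) p \<noteq> \<zero>\<^bsub>K\<^esub>} \<subseteq> ?S" using r s by (auto simp: free_module_simps)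
      from L[OF rs S(1) this S(2)] show ?thesis by (simp add: free_module_simps)
    qed
    also have "\<dots> = (\<Oplus>\<^bsub>U\<^esub>p \<in> ?S. r p \<odot>\<^bsub>U\<^esub> \<phi> p \<oplus>\<^bsub>U\<^esub> s p \<odot>\<^bsub>U\<^esub> \<phi> p)"
      by (rule U.M.finsum_cong') (use r s S assms(2) in \<open>auto simp: free_module_simps U.smult_l_distr Pi_def subset_iff\<close>)
    also have "\<dots> = (\<Oplus>\<^bsub>U\<^esub>p \<in> ?S. r p \<odot>\<^bsub>U\<^esub> \<phi> p) \<oplus>\<^bsub>U\<^esub> (\<Oplus>\<^bsub>U\<^esub>p \<in> ?S. s p \<odot>\<^bsub>U\<^esub> \<phi> p)"
      by (rule U.M.finsum_addf) (use r s S assms(2) in \<open>auto simp: free_module_simps Pi_def subset_iff\<close>)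
    finally show ?thesis using L[OF r S(1) _ S(2)] L[OF s S(1) _ S(2)] by simp
  qed
  have sc: "lin_ext K U (c \<odot>\<^bsub>?F\<^esub> r) \<phi> = c \<odot>\<^bsub>U\<^esub> lin_ext K U r \<phi>"
    if r: "r \<in> carrier ?F" and c: "c \<in> carrier K" for r c
  proof -
    let ?S = "{p. r p \<noteq> \<zero>\<^bsub>K\<^esub>}"
    have cr: "c \<odot>\<^bsub>?F\<^esub> r \<in> carrier ?F" using r c by simp
    have S: "finite ?S" "?S \<subseteq> X" using r by (auto simp: free_module_simps)
    have sub: "{p. (c \<odot>\<^bsub>?F\<^esub> r) p \<noteq> \<zero>\<^bsub>K\<^esub>} \<subseteq> ?S" using c by (auto simp: free_module_simps)
    have "lin_ext K U (c \<odot>\<^bsub>?F\<^esub> r) \<phi> = (\<Oplus>\<^bsub>U\<^esub>p \<in> ?S. (c \<otimes>\<^bsub>K\<^esub> r p) \<odot>\<^bsub>U\<^esub> \<phi> p)"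
      using L[OF cr S(1) sub S(2)] by (auto simp: free_module_simps)
    also have "\<dots> = (\<Oplus>\<^bsub>U\<^esub>p \<in> ?S. c \<odot>\<^bsub>U\<^esub> (r p \<odot>\<^bsub>U\<^esub> \<phi> p))"
      by (rule U.M.finsum_cong') (use r c S assms(2) in \<open>auto simp: free_module_simps U.smult_assoc1 Pi_def subset_iff\<close>)
    also have "\<dots> = c \<odot>\<^bsub>U\<^esub> (\<Oplus>\<^bsub>U\<^esub>p \<in> ?S. r p \<odot>\<^bsub>U\<^esub> \<phi> p)"
      by (rule U.finsum_smult_ldistr[symmetric]) (use r c S assms(2) in \<open>auto simp: free_module_simps\<close>)
    finally show ?thesis by (simp add: lin_ext_def)
  qed
  show ?thesis unfolding linear_map_def using cl ad sc by auto
qed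

lemma lin_ext_gen:
  assumes "module K U" "\<phi> \<in> X \<rightarrow> carrier U" "x \<in> X"
  shows "lin_ext K U (free_gen K x) \<phi> = \<phi> x"
proof -
  interpret U: module K U by fact
  have "lin_ext K U (free_gen K x) \<phi> = (\<Oplus>\<^bsub>U\<^esub>p \<in> {x}. free_gen K x p \<odot>\<^bsub>U\<^esub> \<phi> p)"
    by (rule lin_ext_superset[OF assms(1) free_gen_closed assms(2)])
       (use assms in \<open>auto simp: free_gen_def U.is_cring\<close>)
  also have "\<dots> = \<phi> x"
  proof -
    have "\<phi> x \<in> carrier U" using assms by auto
    then show ?thesis by (simp add: free_gen_def U.M.add.finprod_insert[of "{}", simplified])
  qed
  finally show ?thesis .
qed

lemma linear_map_minus:
  assumes "module K V" "module K W" "linear_map K V W f" "x \<in> carrier V" "y \<in> carrier V"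
  shows "f (x \<ominus>\<^bsub>V\<^esub> y) = f x \<ominus>\<^bsub>W\<^esub> f y"
proof -
  interpret V: module K V by fact
  interpret W: module K W by fact
  have 1: "\<ominus>\<^bsub>V\<^esub> y = (\<ominus>\<^bsub>K\<^esub> \<one>\<^bsub>K\<^esub>) \<odot>\<^bsub>V\<^esub> y" using assms by (simp add: V.smult_l_minus)
  have fy: "f y \<in> carrier W" using assms by (auto simp: linear_map_def)
  have 2: "\<ominus>\<^bsub>W\<^esub> f y = (\<ominus>\<^bsub>K\<^esub> \<one>\<^bsub>K\<^esub>) \<odot>\<^bsub>W\<^esub> f y" using fy by (simp add: W.smult_l_minus)
  show ?thesis unfolding a_minus_def 1 2 using assms by (auto simp: linear_map_def)
qed

lemma lin_ext_relations:
  assumes "module K V" "module K W" "module K U" "bilinear_map K V W U \<beta>"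
    and r: "r \<in> tensor_relations K V W"
  shows "lin_ext K U r (\<lambda>p. \<beta> (fst p) (snd p)) = \<zero>\<^bsub>U\<^esub>"
proof -
  interpret V: module K V by fact
  interpret W: module K W by fact
  interpret U: module K U by fact
  let ?X = "carrier V \<times> carrier W"
  let ?F = "free_module K ?X"
  interpret F: module K ?F by (rule free_module_module) unfold_locales
  let ?\<phi> = "\<lambda>p. \<beta> (fst p) (snd p)"
  have \<phi>: "?\<phi> \<in> ?X \<rightarrow> carrier U" using assms(4) by (simp add: bilinear_map_def linear_map_def Pi_def)
  have lin: "linear_map K ?F U (\<lambda>r. lin_ext K U r ?\<phi>)" by (rule lin_ext_linear[OF assms(3) \<phi>])
  note gen = lin_ext_gen[OF assms(3) \<phi>]
  note mi = linear_map_minus[OF F.module_axioms assms(3) lin]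
  let ?N = "{r \<in> carrier ?F. lin_ext K U r ?\<phi> = \<zero>\<^bsub>U\<^esub>}"
  have N0: "\<zero>\<^bsub>?F\<^esub> \<in> ?N" by (auto simp: lin_ext_def free_module_simps V.R.zero_closed)
  have "submodule ?N K ?F"
  proof (rule F.submoduleI)
    show "\<ominus>\<^bsub>?F\<^esub> a \<in> ?N" if "a \<in> ?N" for a
      using that mi[of "\<zero>\<^bsub>?F\<^esub>" a] N0 by (auto simp: a_minus_def)
  qed (use lin N0 in \<open>auto simp: linear_map_def\<close>)
  moreover have fg: "free_gen K (v,w) \<in> carrier ?F" if "v \<in> carrier V" "w \<in> carrier W" for v w
    using that by (auto intro: free_gen_closed V.is_cring)
  moreover have mem: "a \<ominus>\<^bsub>?F\<^esub> b \<in> ?N" if "a \<in> carrier ?F" "b \<in> carrier ?F" "lin_ext K U a ?\<phi> = lin_ext K U b ?\<phi>" for a b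
    using that mi[of a b] lin by (auto simp: linear_map_def a_minus_def U.M.r_neg Pi_def)
  have "tensor_generators K V W \<subseteq> ?N"
    unfolding tensor_generators_def Let_def
    apply (intro Un_least subsetI; elim CollectE exE conjE; simp only:; rule mem)
    using assms(4) lin by (auto simp: fg gen linear_map_def bilinear_map_def)
  ultimately have "tensor_relations K V W \<subseteq> ?N"
    unfolding tensor_relations_def by (intro hull_minimal) auto
  then show ?thesis using r by auto
qed

lemma sweedler_coset:
  assumes "module K V" "module K W" "module K U" "bilinear_map K V W U \<beta>"
    and r: "r \<in> carrier (free_module K (carrier V \<times> carrier W))"
  shows "sweedler K U (tensor_relations K V W +>\<^bsub>free_module K (carrier V \<times> carrier W)\<^esub> r) \<beta> =
     lin_ext K U r (\<lambda>p. \<beta> (fst p) (snd p))"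
proof -
  interpret U: module K U by fact
  let ?X = "carrier V \<times> carrier W"
  let ?F = "free_module K ?X"
  let ?\<phi> = "\<lambda>p. \<beta> (fst p) (snd p)"
  let ?R = "tensor_relations K V W"
  interpret F: module K ?F by (rule free_module_module) unfold_locales
  interpret N: submodule ?R K ?F by (rule tensor_relations_submodule[OF assms(1,2)])
  interpret A: abelian_subgroup ?R ?F
    by (intro abelian_subgroupI3 additive_subgroup.intro F.M.abelian_group_axioms N.subgroup_axioms)
  have \<phi>: "?\<phi> \<in> ?X \<rightarrow> carrier U" using assms(4) by (simp add: bilinear_map_def linear_map_def Pi_def)
  have lin: "linear_map K ?F U (\<lambda>r. lin_ext K U r ?\<phi>)" by (rule lin_ext_linear[OF assms(3) \<phi>])
  define s where "s = (SOME s. s \<in> ?R +>\<^bsub>?F\<^esub> r)"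
  have "s \<in> ?R +>\<^bsub>?F\<^esub> r" unfolding s_def by (rule someI[where P = "\<lambda>s. s \<in> _", OF A.a_rcos_self[OF r]])
  then obtain n where n: "n \<in> ?R" "s = n \<oplus>\<^bsub>?F\<^esub> r" by (auto simp: a_r_coset_def')
  have "lin_ext K U s ?\<phi> = lin_ext K U n ?\<phi> \<oplus>\<^bsub>U\<^esub> lin_ext K U r ?\<phi>"
    using n r lin A.a_subset by (auto simp: linear_map_def)
  also have "\<dots> = lin_ext K U r ?\<phi>"
    using lin_ext_relations[OF assms(1-4) n(1)] lin r by (auto simp: linear_map_def Pi_def)
  finally show ?thesis unfolding sweedler_def Let_def s_def[symmetric] lin_ext_def .
qed

lemma sweedler_tens:
  assumes "module K V" "module K W" "module K U" "bilinear_map K V W U \<beta>"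
    and "v \<in> carrier V" "w \<in> carrier W"
  shows "sweedler K U (tens K V W v w) \<beta> = \<beta> v w"
proof -
  have \<phi>: "(\<lambda>p. \<beta> (fst p) (snd p)) \<in> carrier V \<times> carrier W \<rightarrow> carrier U"
    using assms(4) by (simp add: bilinear_map_def linear_map_def Pi_def)
  show ?thesis unfolding tens_def
    using sweedler_coset[OF assms(1-4) free_gen_closed[OF module.axioms(1)[OF assms(1)]], of "(v, w)"]
      lin_ext_gen[OF assms(3) \<phi>, of "(v,w)"] assms(5,6) by simp
qed

lemma linear_map_sweedler:
  assumes "module K V" "module K W" "module K U" "bilinear_map K V W U \<beta>"
  shows "linear_map K (tensor_space K V W) U (\<lambda>t. sweedler K U t \<beta>)"
proof -
  interpret U: module K U by fact
  let ?X = "carrier V \<times> carrier W"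
  let ?F = "free_module K ?X"
  let ?\<phi> = "\<lambda>p. \<beta> (fst p) (snd p)"
  let ?R = "tensor_relations K V W"
  interpret F: module K ?F by (rule free_module_module) unfold_locales
  interpret N: submodule ?R K ?F by (rule tensor_relations_submodule[OF assms(1,2)])
  interpret A: abelian_subgroup ?R ?F
    by (intro abelian_subgroupI3 additive_subgroup.intro F.M.abelian_group_axioms N.subgroup_axioms)
  have \<phi>: "?\<phi> \<in> ?X \<rightarrow> carrier U" using assms(4) by (simp add: bilinear_map_def linear_map_def Pi_def)
  have lin: "linear_map K ?F U (\<lambda>r. lin_ext K U r ?\<phi>)" by (rule lin_ext_linear[OF assms(3) \<phi>])
  note sw = sweedler_coset[OF assms]
  have car: "carrier (tensor_space K V W) = {?R +>\<^bsub>?F\<^esub> x |x. x \<in> carrier ?F}"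
    by (auto simp: tensor_space_def quotient_module_def A_RCOSETS_def')
  have plus: "(?R +>\<^bsub>?F\<^esub> x) \<oplus>\<^bsub>tensor_space K V W\<^esub> (?R +>\<^bsub>?F\<^esub> y) = ?R +>\<^bsub>?F\<^esub> (x \<oplus>\<^bsub>?F\<^esub> y)"
    if "x \<in> carrier ?F" "y \<in> carrier ?F" for x y
    using that by (simp add: tensor_space_def quotient_module_def A.a_rcos_sum)
  note sm = quotient_module_module(2)[OF F.module_axioms N.submodule_axioms, folded tensor_space_def]
  show ?thesis unfolding linear_map_def
    using lin by (auto simp: car plus sm sw linear_map_def Pi_def)
qed

lemma bilinear_map_tens:
  assumes "module K V" "module K W"
  shows "bilinear_map K V W (tensor_space K V W) (tens K V W)"
proof -
  interpret V: module K V by fact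
  interpret W: module K W by fact
  let ?X = "carrier V \<times> carrier W"
  let ?F = "free_module K ?X"
  let ?R = "tensor_relations K V W"
  interpret F: module K ?F by (rule free_module_module) unfold_locales
  interpret N: submodule ?R K ?F by (rule tensor_relations_submodule[OF assms(1,2)])
  interpret A: abelian_subgroup ?R ?F
    by (intro abelian_subgroupI3 additive_subgroup.intro F.M.abelian_group_axioms N.subgroup_axioms)
  have plus: "(?R +>\<^bsub>?F\<^esub> x) \<oplus>\<^bsub>tensor_space K V W\<^esub> (?R +>\<^bsub>?F\<^esub> y) = ?R +>\<^bsub>?F\<^esub> (x \<oplus>\<^bsub>?F\<^esub> y)"
    if "x \<in> carrier ?F" "y \<in> carrier ?F" for x y
    using that by (simp add: tensor_space_def quotient_module_def A.a_rcos_sum)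
  note sm = quotient_module_module(2)[OF F.module_axioms N.submodule_axioms, folded tensor_space_def]
  have fg: "free_gen K (v,w) \<in> carrier ?F" if "v \<in> carrier V" "w \<in> carrier W" for v w
    using that by (auto intro: free_gen_closed V.is_cring)
  have gens: "tensor_generators K V W \<subseteq> ?R" unfolding tensor_relations_def by (rule hull_subset)
  have eq: "?R +>\<^bsub>?F\<^esub> a = ?R +>\<^bsub>?F\<^esub> b"
    if "a \<ominus>\<^bsub>?F\<^esub> b \<in> tensor_generators K V W" "a \<in> carrier ?F" "b \<in> carrier ?F" for a b
  proof -
    have "a \<ominus>\<^bsub>?F\<^esub> b \<in> ?R" using that gens by auto
    then have "?R +>\<^bsub>?F\<^esub> (a \<ominus>\<^bsub>?F\<^esub> b) = ?R"
      using F.M.a_coset_join2 N.subgroup_axioms that by auto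
    then show ?thesis using F.M.a_coset_add_inv1 that A.a_subset by (simp add: a_minus_def)
  qed
  have cl: "v \<in> carrier V \<Longrightarrow> w \<in> carrier W \<Longrightarrow> tens K V W v w \<in> carrier (tensor_space K V W)" for v w
    using tens_carrier[OF assms] .
  have a1: "tens K V W (v \<oplus>\<^bsub>V\<^esub> v') w = tens K V W v w \<oplus>\<^bsub>tensor_space K V W\<^esub> tens K V W v' w"
    if "v \<in> carrier V" "v' \<in> carrier V" "w \<in> carrier W" for v v' w
    unfolding tens_def plus[OF fg[OF that(1,3)] fg[OF that(2,3)]]
    by (rule eq) (use that fg in \<open>simp_all add: tensor_generators_def Let_def, blast\<close>)
  have a2: "tens K V W v (w \<oplus>\<^bsub>W\<^esub> w') = tens K V W v w \<oplus>\<^bsub>tensor_space K V W\<^esub> tens K V W v w'"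
    if "v \<in> carrier V" "w \<in> carrier W" "w' \<in> carrier W" for v w w'
    unfolding tens_def plus[OF fg[OF that(1,2)] fg[OF that(1,3)]]
    by (rule eq) (use that fg in \<open>simp_all add: tensor_generators_def Let_def, blast\<close>)
  have s1: "tens K V W (c \<odot>\<^bsub>V\<^esub> v) w = c \<odot>\<^bsub>tensor_space K V W\<^esub> tens K V W v w"
    if "c \<in> carrier K" "v \<in> carrier V" "w \<in> carrier W" for c v w
    unfolding tens_def sm[OF fg[OF that(2,3)] that(1)]
    by (rule eq) (use that fg in \<open>simp_all add: tensor_generators_def Let_def, blast\<close>)
  have s2: "tens K V W v (c \<odot>\<^bsub>W\<^esub> w) = c \<odot>\<^bsub>tensor_space K V W\<^esub> tens K V W v w"
    if "c \<in> carrier K" "v \<in> carrier V" "w \<in> carrier W" for c v w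
    unfolding tens_def sm[OF fg[OF that(2,3)] that(1)]
    by (rule eq) (use that fg in \<open>simp_all add: tensor_generators_def Let_def, blast\<close>)
  show ?thesis unfolding bilinear_map_def linear_map_def
    by (simp add: cl a1 a2 s1 s2)
qed


section \<open>Hopf algebras\<close>

record ('k, 'a) bialg = "('k, 'a) module" +
  comult :: "'a \<Rightarrow> ('k, 'a, 'a) tensor"
  counit :: "'a \<Rightarrow> 'k"

text \<open>The locale \<^locale>\<open>algebra\<close> of the library is restricted to commutative algebras.\<close>

locale assoc_algebra = module K A + ring A for K and A (structure) +
  assumes smult_mult_left:
      "\<lbrakk>c \<in> carrier K; x \<in> carrier A; y \<in> carrier A\<rbrakk> \<Longrightarrow> (c \<odot>\<^bsub>A\<^esub> x) \<otimes>\<^bsub>A\<^esub> y = c \<odot>\<^bsub>A\<^esub> (x \<otimes>\<^bsub>A\<^esub> y)"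
    and smult_mult_right:
      "\<lbrakk>c \<in> carrier K; x \<in> carrier A; y \<in> carrier A\<rbrakk> \<Longrightarrow> x \<otimes>\<^bsub>A\<^esub> (c \<odot>\<^bsub>A\<^esub> y) = c \<odot>\<^bsub>A\<^esub> (x \<otimes>\<^bsub>A\<^esub> y)"

locale coalgebra = module K C for K and C :: "('k, 'c, 'e) bialg_scheme" (structure) +
  assumes comult_linear: "linear_map K C (tensor_space K C C) (comult C)"
    and counit_linear: "linear_map K C (field_as_module K) (counit C)"
    and coassoc:
      "c \<in> carrier C \<Longrightarrow>
        sweedler K (tensor_space K C (tensor_space K C C)) (comult C c) (\<lambda>c1 c2.
          sweedler K (tensor_space K C (tensor_space K C C)) (comult C c1) (\<lambda>c11 c12.
            tens K C (tensor_space K C C) c11 (tens K C C c12 c2))) =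
        sweedler K (tensor_space K C (tensor_space K C C)) (comult C c) (\<lambda>c1 c2.
          tens K C (tensor_space K C C) c1 (comult C c2))"
    and counit_left:
      "c \<in> carrier C \<Longrightarrow> sweedler K C (comult C c) (\<lambda>c1 c2. counit C c1 \<odot>\<^bsub>C\<^esub> c2) = c"
    and counit_right:
      "c \<in> carrier C \<Longrightarrow> sweedler K C (comult C c) (\<lambda>c1 c2. counit C c2 \<odot>\<^bsub>C\<^esub> c1) = c"

definition has_antipode :: "('k, 'q) ring_scheme \<Rightarrow> ('k, 'a, 'e) bialg_scheme \<Rightarrow> bool"
  where "has_antipode K A \<longleftrightarrow>
    (\<exists>S. linear_map K A A S \<and>
      (\<forall>a\<in>carrier A.
        sweedler K A (comult A a) (\<lambda>a1 a2. S a1 \<otimes>\<^bsub>A\<^esub> a2) = counit A a \<odot>\<^bsub>A\<^esub> \<one>\<^bsub>A\<^esub> \<and>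
        sweedler K A (comult A a) (\<lambda>a1 a2. a1 \<otimes>\<^bsub>A\<^esub> S a2) = counit A a \<odot>\<^bsub>A\<^esub> \<one>\<^bsub>A\<^esub>))"

locale hopf_algebra = assoc_algebra K A + coalgebra K A
  for K and A :: "('k, 'a, 'e) bialg_scheme" (structure) +
  assumes comult_one: "comult A \<one>\<^bsub>A\<^esub> = tens K A A \<one>\<^bsub>A\<^esub> \<one>\<^bsub>A\<^esub>"
    and comult_mult:
      "\<lbrakk>x \<in> carrier A; y \<in> carrier A\<rbrakk> \<Longrightarrow>
        comult A (x \<otimes>\<^bsub>A\<^esub> y) =
        sweedler K (tensor_space K A A) (comult A x) (\<lambda>x1 x2.
          sweedler K (tensor_space K A A) (comult A y) (\<lambda>y1 y2.
            tens K A A (x1 \<otimes>\<^bsub>A\<^esub> y1) (x2 \<otimes>\<^bsub>A\<^esub> y2)))"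
    and counit_one: "counit A \<one>\<^bsub>A\<^esub> = \<one>\<^bsub>K\<^esub>"
    and counit_mult:
      "\<lbrakk>x \<in> carrier A; y \<in> carrier A\<rbrakk> \<Longrightarrow> counit A (x \<otimes>\<^bsub>A\<^esub> y) = counit A x \<otimes>\<^bsub>K\<^esub> counit A y"
    and antipode: "has_antipode K A"

definition algebra_map ::
    "('k, 'q) ring_scheme \<Rightarrow> ('k, 'a, 'm) module_scheme \<Rightarrow> ('k, 'b, 'n) module_scheme \<Rightarrow> ('a \<Rightarrow> 'b) \<Rightarrow> bool"
  where "algebra_map K A B f \<longleftrightarrow> linear_map K A B f \<and> f \<in> ring_hom A B"

definition coalgebra_map ::
    "('k, 'q) ring_scheme \<Rightarrow> ('k, 'c, 'm) bialg_scheme \<Rightarrow> ('k, 'd, 'n) bialg_scheme \<Rightarrow> ('c \<Rightarrow> 'd) \<Rightarrow> bool"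
  where "coalgebra_map K C D f \<longleftrightarrow>
    linear_map K C D f \<and>
    (\<forall>c\<in>carrier C.
      comult D (f c) = sweedler K (tensor_space K D D) (comult C c) (\<lambda>c1 c2. tens K D D (f c1) (f c2)) \<and>
      counit D (f c) = counit C c)"

text \<open>An algebra and coalgebra map between Hopf algebras automatically preserves antipodes.\<close>

definition hopf_map ::
    "('k, 'q) ring_scheme \<Rightarrow> ('k, 'a, 'm) bialg_scheme \<Rightarrow> ('k, 'b, 'n) bialg_scheme \<Rightarrow> ('a \<Rightarrow> 'b) \<Rightarrow> bool"
  where "hopf_map K A B f \<longleftrightarrow> algebra_map K A B f \<and> coalgebra_map K A B f"


section \<open>Hopf algebras in the Yetter-Drinfel'd category\<close>

record ('k, 'h, 'b) yd = "('k, 'b) bialg" +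
  action :: "'h \<Rightarrow> 'b \<Rightarrow> 'b"
  coaction :: "'b \<Rightarrow> ('k, 'h, 'b) tensor"

locale yd_hopf_algebra =
  H: hopf_algebra K H + B: assoc_algebra K B + B: coalgebra K B
  for K :: "('k, 'q) ring_scheme" and H :: "('k, 'h, 'd) bialg_scheme" and B :: "('k, 'h, 'b, 'e) yd_scheme" +
    \<comment> \<open>module\<close>
  assumes action_bilinear: "bilinear_map K H B B (action B)"
    and action_one: "b \<in> carrier B \<Longrightarrow> action B \<one>\<^bsub>H\<^esub> b = b"
    and action_mult:
      "\<lbrakk>h \<in> carrier H; h' \<in> carrier H; b \<in> carrier B\<rbrakk> \<Longrightarrow>
        action B (h \<otimes>\<^bsub>H\<^esub> h') b = action B h (action B h' b)"
    \<comment> \<open>comodule\<close>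
    and coaction_linear: "linear_map K B (tensor_space K H B) (coaction B)"
    and coaction_coassoc:
      "b \<in> carrier B \<Longrightarrow>
        sweedler K (tensor_space K H (tensor_space K H B)) (coaction B b) (\<lambda>x b0.
          sweedler K (tensor_space K H (tensor_space K H B)) (comult H x) (\<lambda>x1 x2.
            tens K H (tensor_space K H B) x1 (tens K H B x2 b0))) =
        sweedler K (tensor_space K H (tensor_space K H B)) (coaction B b) (\<lambda>x b0.
          tens K H (tensor_space K H B) x (coaction B b0))"
    and coaction_counit:
      "b \<in> carrier B \<Longrightarrow> sweedler K B (coaction B b) (\<lambda>x b0. counit H x \<odot>\<^bsub>B\<^esub> b0) = b"
    \<comment> \<open>module algebra\<close>
    and action_on_one: "h \<in> carrier H \<Longrightarrow> action B h \<one>\<^bsub>B\<^esub> = counit H h \<odot>\<^bsub>B\<^esub> \<one>\<^bsub>B\<^esub>"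
    and action_on_mult:
      "\<lbrakk>h \<in> carrier H; b \<in> carrier B; b' \<in> carrier B\<rbrakk> \<Longrightarrow>
        action B h (b \<otimes>\<^bsub>B\<^esub> b') =
        sweedler K B (comult H h) (\<lambda>h1 h2. action B h1 b \<otimes>\<^bsub>B\<^esub> action B h2 b')"
    \<comment> \<open>module coalgebra\<close>
    and counit_action:
      "\<lbrakk>h \<in> carrier H; b \<in> carrier B\<rbrakk> \<Longrightarrow>
        counit B (action B h b) = counit H h \<otimes>\<^bsub>K\<^esub> counit B b"
    and comult_action:
      "\<lbrakk>h \<in> carrier H; b \<in> carrier B\<rbrakk> \<Longrightarrow>
        comult B (action B h b) =
        sweedler K (tensor_space K B B) (comult H h) (\<lambda>h1 h2.
          sweedler K (tensor_space K B B) (comult B b) (\<lambda>b1 b2.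
            tens K B B (action B h1 b1) (action B h2 b2)))"
    \<comment> \<open>comodule algebra\<close>
    and coaction_one: "coaction B \<one>\<^bsub>B\<^esub> = tens K H B \<one>\<^bsub>H\<^esub> \<one>\<^bsub>B\<^esub>"
    and coaction_mult:
      "\<lbrakk>b \<in> carrier B; b' \<in> carrier B\<rbrakk> \<Longrightarrow>
        coaction B (b \<otimes>\<^bsub>B\<^esub> b') =
        sweedler K (tensor_space K H B) (coaction B b) (\<lambda>x b0.
          sweedler K (tensor_space K H B) (coaction B b') (\<lambda>x' b0'.
            tens K H B (x \<otimes>\<^bsub>H\<^esub> x') (b0 \<otimes>\<^bsub>B\<^esub> b0')))"
    \<comment> \<open>comodule coalgebra\<close>
    and coaction_counit_coalgebra:
      "b \<in> carrier B \<Longrightarrow>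
        sweedler K H (coaction B b) (\<lambda>x b0. counit B b0 \<odot>\<^bsub>H\<^esub> x) = counit B b \<odot>\<^bsub>H\<^esub> \<one>\<^bsub>H\<^esub>"
    and coaction_comult:
      "b \<in> carrier B \<Longrightarrow>
        sweedler K (tensor_space K H (tensor_space K B B)) (comult B b) (\<lambda>b1 b2.
          sweedler K (tensor_space K H (tensor_space K B B)) (coaction B b1) (\<lambda>x1 b10.
            sweedler K (tensor_space K H (tensor_space K B B)) (coaction B b2) (\<lambda>x2 b20.
              tens K H (tensor_space K B B) (x1 \<otimes>\<^bsub>H\<^esub> x2) (tens K B B b10 b20)))) =
        sweedler K (tensor_space K H (tensor_space K B B)) (coaction B b) (\<lambda>x b0.
          tens K H (tensor_space K B B) x (comult B b0))"
    \<comment> \<open>braided bialgebra\<close>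
    and counit_one: "counit B \<one>\<^bsub>B\<^esub> = \<one>\<^bsub>K\<^esub>"
    and counit_mult:
      "\<lbrakk>b \<in> carrier B; b' \<in> carrier B\<rbrakk> \<Longrightarrow> counit B (b \<otimes>\<^bsub>B\<^esub> b') = counit B b \<otimes>\<^bsub>K\<^esub> counit B b'"
    and comult_one: "comult B \<one>\<^bsub>B\<^esub> = tens K B B \<one>\<^bsub>B\<^esub> \<one>\<^bsub>B\<^esub>"
    and comult_mult:
      "\<lbrakk>b \<in> carrier B; b' \<in> carrier B\<rbrakk> \<Longrightarrow>
        comult B (b \<otimes>\<^bsub>B\<^esub> b') =
        sweedler K (tensor_space K B B) (comult B b) (\<lambda>b1 b2.
          sweedler K (tensor_space K B B) (coaction B b2) (\<lambda>x b20.
            sweedler K (tensor_space K B B) (comult B b') (\<lambda>b1' b2'.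
              tens K B B (b1 \<otimes>\<^bsub>B\<^esub> action B x b1') (b20 \<otimes>\<^bsub>B\<^esub> b2'))))"
    \<comment> \<open>compatibility of action and coaction\<close>
    and yetter_drinfeld:
      "\<lbrakk>h \<in> carrier H; b \<in> carrier B\<rbrakk> \<Longrightarrow>
        sweedler K (tensor_space K H B) (comult H h) (\<lambda>h1 h2.
          sweedler K (tensor_space K H B) (coaction B b) (\<lambda>x b0.
            tens K H B (h1 \<otimes>\<^bsub>H\<^esub> x) (action B h2 b0))) =
        sweedler K (tensor_space K H B) (comult H h) (\<lambda>h1 h2.
          sweedler K (tensor_space K H B) (coaction B (action B h1 b)) (\<lambda>x b0.
            tens K H B (x \<otimes>\<^bsub>H\<^esub> h2) b0))"
    and braided_antipode: "has_antipode K B"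


section \<open>The biproduct\<close>

definition biproduct ::
    "('k, 'q) ring_scheme \<Rightarrow> ('k, 'h, 'd) bialg_scheme \<Rightarrow> ('k, 'h, 'b, 'e) yd_scheme \<Rightarrow>
     ('k, ('k, 'b, 'h) tensor) bialg"
  where "biproduct K H B =
    (let T = tensor_space K B H in
     \<lparr>carrier = carrier T,
      mult = (\<lambda>s t. sweedler K T s (\<lambda>b h. sweedler K T t (\<lambda>b' h'. sweedler K T (comult H h) (\<lambda>h1 h2.
                tens K B H (b \<otimes>\<^bsub>B\<^esub> action B h1 b') (h2 \<otimes>\<^bsub>H\<^esub> h'))))),
      one = tens K B H \<one>\<^bsub>B\<^esub> \<one>\<^bsub>H\<^esub>,
      zero = \<zero>\<^bsub>T\<^esub>,
      add = add T,
      smult = smult T,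
      comult = (\<lambda>t. sweedler K (tensor_space K T T) t (\<lambda>b h.
                  sweedler K (tensor_space K T T) (comult B b) (\<lambda>b1 b2.
                    sweedler K (tensor_space K T T) (coaction B b2) (\<lambda>x b20.
                      sweedler K (tensor_space K T T) (comult H h) (\<lambda>h1 h2.
                        tens K T T (tens K B H b1 (x \<otimes>\<^bsub>H\<^esub> h1)) (tens K B H b20 h2)))))),
      counit = (\<lambda>t. sweedler K (field_as_module K) t (\<lambda>b h. counit B b \<otimes>\<^bsub>K\<^esub> counit H h))\<rparr>)"

definition biproduct_proj ::
    "('k, 'q) ring_scheme \<Rightarrow> ('k, 'h, 'd) bialg_scheme \<Rightarrow> ('k, 'h, 'b, 'e) yd_scheme \<Rightarrow>
     ('k, 'b, 'h) tensor \<Rightarrow> 'h"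
  where "biproduct_proj K H B t = sweedler K H t (\<lambda>b h. counit B b \<odot>\<^bsub>H\<^esub> h)"

definition biproduct_incl ::
    "('k, 'q) ring_scheme \<Rightarrow> ('k, 'h, 'd) bialg_scheme \<Rightarrow> ('k, 'h, 'b, 'e) yd_scheme \<Rightarrow>
     'h \<Rightarrow> ('k, 'b, 'h) tensor"
  where "biproduct_incl K H B h = tens K B H \<one>\<^bsub>B\<^esub> h"


section \<open>Endomorphism monoids and automorphism groups\<close>

text \<open>
  Maps are required to be extensional on the carrier, so that two endomorphisms are equal iff they
  agree on the carrier.
\<close>

definition End_Hopf ::
    "('k, 'q) ring_scheme \<Rightarrow> ('k, 'h, 'd) bialg_scheme \<Rightarrow> ('k, 'a, 'e) bialg_scheme \<Rightarrow>
     ('a \<Rightarrow> 'h) \<Rightarrow> ('h \<Rightarrow> 'a) \<Rightarrow> ('a \<Rightarrow> 'a) monoid"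
  where "End_Hopf K H A p j =
    \<lparr>carrier = {F \<in> extensional (carrier A). hopf_map K A A F \<and>
       (\<forall>a\<in>carrier A. p (F a) = p a) \<and> (\<forall>h\<in>carrier H. F (j h) = j h)},
     mult = compose (carrier A),
     one = (\<lambda>a\<in>carrier A. a)\<rparr>"

definition Aut_Hopf ::
    "('k, 'q) ring_scheme \<Rightarrow> ('k, 'h, 'd) bialg_scheme \<Rightarrow> ('k, 'a, 'e) bialg_scheme \<Rightarrow>
     ('a \<Rightarrow> 'h) \<Rightarrow> ('h \<Rightarrow> 'a) \<Rightarrow> ('a \<Rightarrow> 'a) monoid"
  where "Aut_Hopf K H A p j =
    (End_Hopf K H A p j)\<lparr>carrier :=
       {F \<in> carrier (End_Hopf K H A p j). bij_betw F (carrier A) (carrier A)}\<rparr>"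

definition End_YD ::
    "('k, 'q) ring_scheme \<Rightarrow> ('k, 'h, 'd) bialg_scheme \<Rightarrow> ('k, 'h, 'b, 'e) yd_scheme \<Rightarrow> ('b \<Rightarrow> 'b) monoid"
  where "End_YD K H B =
    \<lparr>carrier = {f \<in> extensional (carrier B). algebra_map K B B f \<and> coalgebra_map K B B f \<and>
       (\<forall>h\<in>carrier H. \<forall>b\<in>carrier B. f (action B h b) = action B h (f b)) \<and>
       (\<forall>b\<in>carrier B. coaction B (f b) =
          sweedler K (tensor_space K H B) (coaction B b) (\<lambda>x b0. tens K H B x (f b0)))},
     mult = compose (carrier B),
     one = (\<lambda>b\<in>carrier B. b)\<rparr>"

definition Aut_YD ::
    "('k, 'q) ring_scheme \<Rightarrow> ('k, 'h, 'd) bialg_scheme \<Rightarrow> ('k, 'h, 'b, 'e) yd_scheme \<Rightarrow> ('b \<Rightarrow> 'b) monoid"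
  where "Aut_YD K H B = units_of (End_YD K H B)"

definition biproduct_map ::
    "('k, 'q) ring_scheme \<Rightarrow> ('k, 'h, 'd) bialg_scheme \<Rightarrow> ('k, 'h, 'b, 'e) yd_scheme \<Rightarrow>
     ('b \<Rightarrow> 'b) \<Rightarrow> ('k, 'b, 'h) tensor \<Rightarrow> ('k, 'b, 'h) tensor"
  where "biproduct_map K H B f =
    (\<lambda>t\<in>carrier (biproduct K H B). sweedler K (biproduct K H B) t (\<lambda>b h. tens K B H (f b) h))"

end

theory Submission
  imports Defs
begin

text \<open>
  Write \<open>b \<ltimes> h\<close> for a pure tensor of the biproduct \<open>A\<close>, \<open>\<Phi> f\<close> for the map
  \<open>b \<ltimes> h \<mapsto> f(b) \<ltimes> h\<close>, and \<open>\<epsilon>\<close> for all counits. Since product, coproduct and counit of \<open>A\<close> are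
  assembled from the structure maps of \<open>B\<close> and \<open>H\<close>, and \<open>f\<close> commutes with those of \<open>B\<close>, the map
  \<open>\<Phi> f\<close> is a Hopf map; it fixes \<open>1 \<ltimes> h\<close> and preserves \<open>\<pi>(b \<ltimes> h) = \<epsilon>(b)h\<close> because \<open>f\<close> preserves
  unit and counit (\<open>biproduct_map_End_Hopf\<close>).

  The converse rests on the linear map \<open>P(b \<ltimes> h) = \<epsilon>(h)b\<close> from \<open>A\<close> onto \<open>B\<close> (\<open>base_proj\<close>). It is
  a retraction of \<open>b \<mapsto> b \<ltimes> 1\<close>, so \<open>f\<close> is determined by \<open>\<Phi> f\<close>. Moreover
  \<open>a = P(a\<^sub>(\<^sub>1\<^sub>)) \<ltimes> \<pi>(a\<^sub>(\<^sub>2\<^sub>))\<close> for every \<open>a\<close> in \<open>A\<close> (\<open>sweedler_base_proj_proj\<close>). Let \<open>F\<close> be an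
  endomorphism of \<open>A\<close> over \<open>H\<close> and put \<open>f(b) = P(F(b \<ltimes> 1))\<close>. The elements \<open>b \<ltimes> 1\<close> are coinvariant
  for \<open>\<pi>\<close>, and as \<open>F\<close> is a coalgebra map with \<open>\<pi> \<circ> F = \<pi>\<close>, the formula for \<open>a = F(b \<ltimes> 1)\<close> collapses
  to \<open>F(b \<ltimes> 1) = f(b) \<ltimes> 1\<close> (\<open>End_Hopf_preserves_base\<close>). From \<open>b \<ltimes> h = (b \<ltimes> 1)(1 \<ltimes> h)\<close> and
  \<open>F(1 \<ltimes> h) = 1 \<ltimes> h\<close> one gets \<open>F = \<Phi> f\<close>.

  It remains to see that this \<open>f\<close> respects the structure of \<open>B\<close>. All of it can be recovered from \<open>A\<close>
  by means of \<open>P\<close> and \<open>\<pi>\<close>: for \<open>a = b \<ltimes> 1\<close> one has \<open>P(a\<^sub>(\<^sub>1\<^sub>)) \<otimes> P(a\<^sub>(\<^sub>2\<^sub>)) = \<Delta>(b)\<close>,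
  \<open>\<pi>(a\<^sub>(\<^sub>1\<^sub>)) \<otimes> P(a\<^sub>(\<^sub>2\<^sub>)) = \<rho>(b)\<close>, \<open>P((1 \<ltimes> h)a) = h \<cdot> b\<close>, \<open>\<epsilon>(P(a)) = \<epsilon>(a)\<close> and
  \<open>(b \<ltimes> 1)(b' \<ltimes> 1) = bb' \<ltimes> 1\<close>. As \<open>P \<circ> F = f \<circ> P\<close> and \<open>\<pi> \<circ> F = \<pi>\<close>, applying these formulas to \<open>F(a)\<close>
  transports the compatibility of \<open>F\<close> with the structure of \<open>A\<close> to \<open>f\<close> (\<open>End_Hopf_induced\<close>).

  So \<open>\<Phi>\<close> is an isomorphism of monoids. An isomorphism of monoids restricts to the groups of units,
  and the units among the endomorphisms of \<open>A\<close> are the bijective ones, since the inverse of a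
  bijective Hopf map is again a Hopf map (\<open>Aut_Hopf_eq_units\<close>).
\<close>

section \<open>Linear maps and Sweedler sums\<close>

lemma linear_mapI:
  assumes "\<And>x. x \<in> carrier V \<Longrightarrow> f x \<in> carrier W"
    and "\<And>x y. x \<in> carrier V \<Longrightarrow> y \<in> carrier V \<Longrightarrow> f (x \<oplus>\<^bsub>V\<^esub> y) = f x \<oplus>\<^bsub>W\<^esub> f y"
    and "\<And>c x. c \<in> carrier K \<Longrightarrow> x \<in> carrier V \<Longrightarrow> f (c \<odot>\<^bsub>V\<^esub> x) = c \<odot>\<^bsub>W\<^esub> f x"
  shows "linear_map K V W f"
  using assms by (auto simp: linear_map_def)

lemma linear_mapD:
  assumes "linear_map K V W f"
  shows "x \<in> carrier V \<Longrightarrow> f x \<in> carrier W"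
    and "x \<in> carrier V \<Longrightarrow> y \<in> carrier V \<Longrightarrow> f (x \<oplus>\<^bsub>V\<^esub> y) = f x \<oplus>\<^bsub>W\<^esub> f y"
    and "c \<in> carrier K \<Longrightarrow> x \<in> carrier V \<Longrightarrow> f (c \<odot>\<^bsub>V\<^esub> x) = c \<odot>\<^bsub>W\<^esub> f x"
  using assms by (auto simp: linear_map_def)

lemma linear_map_cong:
  assumes "module K V" "linear_map K V W f" "\<And>x. x \<in> carrier V \<Longrightarrow> f x = g x"
  shows "linear_map K V W g"
proof -
  interpret V: module K V by fact
  show ?thesis
    by (rule linear_mapI) (simp_all add: assms(3)[symmetric] linear_mapD[OF assms(2)])
qed

lemma linear_map_compose:
  assumes "linear_map K V W g" "linear_map K U V f"
  shows "linear_map K U W (\<lambda>x. g (f x))"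
  by (rule linear_mapI) (simp_all add: linear_mapD[OF assms(1)] linear_mapD[OF assms(2)])

lemma bilinear_mapI:
  assumes "\<And>u. u \<in> carrier U \<Longrightarrow> linear_map K V W (\<lambda>v. \<beta> u v)"
    and "\<And>v. v \<in> carrier V \<Longrightarrow> linear_map K U W (\<lambda>u. \<beta> u v)"
  shows "bilinear_map K U V W \<beta>"
  using assms by (simp add: bilinear_map_def)

lemma bilinear_map_closed:
  "bilinear_map K U V W \<beta> \<Longrightarrow> u \<in> carrier U \<Longrightarrow> v \<in> carrier V \<Longrightarrow> \<beta> u v \<in> carrier W"
  by (auto simp: bilinear_map_def linear_map_def)

lemma bilinear_map_cong:
  assumes "module K U" "module K V" "bilinear_map K U V W \<beta>"
    "\<And>u v. u \<in> carrier U \<Longrightarrow> v \<in> carrier V \<Longrightarrow> \<beta> u v = \<gamma> u v"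
  shows "bilinear_map K U V W \<gamma>"
  using assms
  by (auto simp: bilinear_map_def intro: linear_map_cong[OF assms(1)] linear_map_cong[OF assms(2)])

lemma linear_map_free_ext:
  assumes U: "module K U"
    and G: "linear_map K (free_module K X) U G" and G': "linear_map K (free_module K X) U G'"
    and gen: "\<And>x. x \<in> X \<Longrightarrow> G (free_gen K x) = G' (free_gen K x)"
    and r: "r \<in> carrier (free_module K X)"
  shows "G r = G' r"
proof -
  interpret U: module K U by fact
  let ?F = "free_module K X"
  interpret F: module K ?F by (rule free_module_module) unfold_locales
  have "G r = G' r"
    if "finite S" "S \<subseteq> X" "r \<in> carrier ?F" "{x. r x \<noteq> \<zero>\<^bsub>K\<^esub>} \<subseteq> S" for S r
    using that
  proof (induction S arbitrary: r rule: finite_induct)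
    case empty
    \<comment> \<open>Here \<open>r = 0\<close>; writing it as \<open>0 \<odot> r\<close> lets linearity evaluate both maps at it.\<close>
    then have "r = \<zero>\<^bsub>K\<^esub> \<odot>\<^bsub>?F\<^esub> r" by (auto simp: free_module_simps)
    then have "G r = \<zero>\<^bsub>K\<^esub> \<odot>\<^bsub>U\<^esub> G r" "G' r = \<zero>\<^bsub>K\<^esub> \<odot>\<^bsub>U\<^esub> G' r"
      using linear_mapD(3)[OF G, of "\<zero>\<^bsub>K\<^esub>" r] linear_mapD(3)[OF G', of "\<zero>\<^bsub>K\<^esub>" r] empty by auto
    then show ?case
      using linear_mapD(1)[OF G empty(2)] linear_mapD(1)[OF G' empty(2)] by simp
  next
    case (insert x S)
    let ?s = "r(x := \<zero>\<^bsub>K\<^esub>)"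
    have xX: "x \<in> X" and rx: "r x \<in> carrier K" using insert by (auto simp: free_module_simps)
    have g: "free_gen K x \<in> carrier ?F" using xX by (intro free_gen_closed U.is_cring)
    have fin: "finite {y. ?s y \<noteq> \<zero>\<^bsub>K\<^esub>}"
      using insert by (auto intro: finite_subset[of _ S])
    have s: "?s \<in> carrier ?F" using insert fin by (auto simp: free_module_simps)
    have "r = ?s \<oplus>\<^bsub>?F\<^esub> r x \<odot>\<^bsub>?F\<^esub> free_gen K x"
      using insert by (auto simp: free_module_simps free_gen_def fun_eq_iff)
    moreover have "L (?s \<oplus>\<^bsub>?F\<^esub> r x \<odot>\<^bsub>?F\<^esub> free_gen K x) = L ?s \<oplus>\<^bsub>U\<^esub> r x \<odot>\<^bsub>U\<^esub> L (free_gen K x)"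
      if "linear_map K ?F U L" for L
      using s g rx by (simp add: linear_mapD[OF that])
    moreover have "G ?s = G' ?s" by (rule insert.IH[OF _ s]) (use insert.prems in auto)
    ultimately show ?case using G G' gen[OF xX] by metis
  qed
  then show ?thesis using r by (auto simp: free_module_simps)
qed

text \<open>
  Pure tensors span. Almost every identity below between linear maps out of a tensor product is
  reduced by this lemma to pure tensors, where Sweedler sums can be evaluated.
\<close>

lemma tensor_ext:
  assumes V: "module K V" and W: "module K W" and U: "module K U"
    and L: "linear_map K (tensor_space K V W) U L" and L': "linear_map K (tensor_space K V W) U L'"
    and eq: "\<And>v w. v \<in> carrier V \<Longrightarrow> w \<in> carrier W \<Longrightarrow> L (tens K V W v w) = L' (tens K V W v w)"
    and t: "t \<in> carrier (tensor_space K V W)"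
  shows "L t = L' t"
proof -
  interpret V: module K V by fact
  let ?F = "free_module K (carrier V \<times> carrier W)"
  let ?R = "tensor_relations K V W"
  interpret F: module K ?F by (rule free_module_module) unfold_locales
  interpret N: submodule ?R K ?F by (rule tensor_relations_submodule[OF V W])
  interpret A: abelian_subgroup ?R ?F
    by (intro abelian_subgroupI3 additive_subgroup.intro F.M.abelian_group_axioms N.subgroup_axioms)
  have car: "carrier (tensor_space K V W) = {?R +>\<^bsub>?F\<^esub> x |x. x \<in> carrier ?F}"
    by (auto simp: tensor_space_def quotient_module_def A_RCOSETS_def')
  have Q: "linear_map K ?F (tensor_space K V W) (\<lambda>r. ?R +>\<^bsub>?F\<^esub> r)"
  proof (rule linear_mapI)
    fix c x assume "c \<in> carrier K" "x \<in> carrier ?F"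
    then show "?R +>\<^bsub>?F\<^esub> (c \<odot>\<^bsub>?F\<^esub> x) = c \<odot>\<^bsub>tensor_space K V W\<^esub> (?R +>\<^bsub>?F\<^esub> x)"
      unfolding tensor_space_def
      by (simp add: quotient_module_module(2)[OF F.module_axioms N.submodule_axioms])
  qed (auto simp: tensor_space_def quotient_module_def A.a_rcos_sum A_RCOSETS_def')
  obtain r where r: "r \<in> carrier ?F" "t = ?R +>\<^bsub>?F\<^esub> r" using t car by auto
  show ?thesis unfolding r(2)
    using eq
    by (intro linear_map_free_ext[OF U linear_map_compose[OF L Q] linear_map_compose[OF L' Q] _ r(1)])
       (auto simp: tens_def)
qed

lemma sweedler_closed:
  assumes "t \<in> carrier (tensor_space K V W)" "bilinear_map K V W U \<beta>"
    "module K V" "module K W" "module K U"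
  shows "sweedler K U t \<beta> \<in> carrier U"
  by (rule linear_mapD(1)[OF linear_map_sweedler]) fact+

text \<open>
  Bilinearity of \<open>\<beta>\<close> passes to \<open>\<gamma>\<close>, since it is a condition on arguments in the carriers.
\<close>

lemma sweedler_cong:
  assumes t: "t \<in> carrier (tensor_space K V W)" and \<beta>: "bilinear_map K V W U \<beta>"
    and mod: "module K V" "module K W" "module K U"
    and eq: "\<And>v w. v \<in> carrier V \<Longrightarrow> w \<in> carrier W \<Longrightarrow> \<beta> v w = \<gamma> v w"
  shows "sweedler K U t \<beta> = sweedler K U t \<gamma>"
proof -
  have \<gamma>: "bilinear_map K V W U \<gamma>" by (rule bilinear_map_cong[OF mod(1,2) \<beta> eq])
  show ?thesis
    by (rule tensor_ext[OF mod linear_map_sweedler linear_map_sweedler _ t])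
       (simp_all add: mod \<beta> \<gamma> eq sweedler_tens[OF mod])
qed

text \<open>
  Read from left to right, this moves a linear map under a Sweedler sum. Read from right to left, it
  collects the factors that do not take part in an identity such as the counit law into \<open>L\<close>, so that
  the identity can be applied inside a larger expression.
\<close>

lemma sweedler_linear:
  assumes t: "t \<in> carrier (tensor_space K V W)" and \<beta>: "bilinear_map K V W U \<beta>"
    and mod: "module K V" "module K W" "module K U" "module K U'" and L: "linear_map K U U' L"
  shows "L (sweedler K U t \<beta>) = sweedler K U' t (\<lambda>v w. L (\<beta> v w))"
proof -
  have L\<beta>: "bilinear_map K V W U' (\<lambda>v w. L (\<beta> v w))"
    using \<beta> by (auto simp: bilinear_map_def intro!: linear_map_compose[OF L])
  show ?thesis
    by (rule tensor_ext[OF mod(1,2,4) linear_map_compose[OF L linear_map_sweedler] linear_map_sweedler _ t])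
       (simp_all add: mod \<beta> L\<beta> sweedler_tens[OF mod(1-3)] sweedler_tens[OF mod(1,2,4)])
qed

lemma sweedler_self:
  assumes t: "t \<in> carrier (tensor_space K V W)" and mod: "module K V" "module K W"
  shows "sweedler K (tensor_space K V W) t (tens K V W) = t"
  by (rule tensor_ext[OF mod tensor_space_module[OF mod] linear_map_sweedler _ _ t])
     (auto simp: mod tensor_space_module bilinear_map_tens sweedler_tens linear_map_def)

text \<open>
  The Sweedler calculus substitutes into nested sums with this rule: if the tensor over which one
  sums is itself given by a Sweedler expression, the two sums are carried out one after the other.
\<close>

lemma sweedler_sweedler:
  assumes s: "s \<in> carrier (tensor_space K X Y)"
    and \<gamma>: "bilinear_map K X Y (tensor_space K V W) \<gamma>" and \<beta>: "bilinear_map K V W U \<beta>"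
    and mod: "module K X" "module K Y" "module K V" "module K W" "module K U"
  shows "sweedler K U (sweedler K (tensor_space K V W) s \<gamma>) \<beta> =
    sweedler K U s (\<lambda>x y. sweedler K U (\<gamma> x y) \<beta>)"
  by (rule sweedler_linear[OF s \<gamma> mod(1,2) tensor_space_module mod(5) linear_map_sweedler])
     (fact mod \<beta>)+

text \<open>
  Needed for nested Sweedler sums, whose inner summand depends on the variables bound further out.
\<close>

lemma linear_map_sweedler_body:
  assumes t: "t \<in> carrier (tensor_space K V W)"
    and bil: "\<And>z. z \<in> carrier Z \<Longrightarrow> bilinear_map K V W U (\<beta> z)"
    and lin: "\<And>v w. v \<in> carrier V \<Longrightarrow> w \<in> carrier W \<Longrightarrow> linear_map K Z U (\<lambda>z. \<beta> z v w)"
    and mod: "module K V" "module K W" "module K U" "module K Z"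
  shows "linear_map K Z U (\<lambda>z. sweedler K U t (\<beta> z))"
proof -
  interpret U: module K U by fact
  interpret Z: module K Z by fact
  note D = linear_mapD[OF linear_map_sweedler[OF mod(1-3) bil]]
  note e = tensor_ext[OF mod(1-3) linear_map_sweedler _ _ t, OF mod(1-3)]
  show ?thesis
  proof (rule linear_mapI)
    fix x y assume xy: "x \<in> carrier Z" "y \<in> carrier Z"
    show "sweedler K U t (\<beta> (x \<oplus>\<^bsub>Z\<^esub> y)) = sweedler K U t (\<beta> x) \<oplus>\<^bsub>U\<^esub> sweedler K U t (\<beta> y)"
    proof (rule e)
      show "linear_map K (tensor_space K V W) U (\<lambda>t. sweedler K U t (\<beta> x) \<oplus>\<^bsub>U\<^esub> sweedler K U t (\<beta> y))"
        by (rule linear_mapI)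
           (use xy in \<open>simp_all add: D(1)[OF xy(1)] D(1)[OF xy(2)] D(2)[OF xy(1)] D(2)[OF xy(2)] D(3)[OF xy(1)] D(3)[OF xy(2)] U.M.a_ac U.smult_r_distr\<close>)
    qed (use xy in \<open>simp_all add: bil sweedler_tens[OF mod(1-3)] linear_mapD[OF lin]\<close>)
  next
    fix c x assume cx: "c \<in> carrier K" "x \<in> carrier Z"
    show "sweedler K U t (\<beta> (c \<odot>\<^bsub>Z\<^esub> x)) = c \<odot>\<^bsub>U\<^esub> sweedler K U t (\<beta> x)"
    proof (rule e)
      show "linear_map K (tensor_space K V W) U (\<lambda>t. c \<odot>\<^bsub>U\<^esub> sweedler K U t (\<beta> x))"
        by (rule linear_mapI)
           (use cx in \<open>simp_all add: D[OF cx(2)] U.smult_r_distr U.smult_assoc1[symmetric] U.m_comm\<close>)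
    qed (use cx in \<open>simp_all add: bil sweedler_tens[OF mod(1-3)] linear_mapD[OF lin]\<close>)
  qed (use t mod bil sweedler_closed in blast)
qed

lemma field_as_module_module:
  assumes "cring K" shows "module K (field_as_module K)"
proof -
  interpret cring K by fact
  have "abelian_group (field_as_module K)"
    by (rule abelian_groupI)
       (auto simp: field_as_module_def a_ac intro: bexI[of _ "\<ominus>\<^bsub>K\<^esub> _"] l_neg)
  then show ?thesis
    by (intro moduleI) (auto simp: field_as_module_def assms m_assoc l_distr r_distr)
qed

lemma linear_map_id: "linear_map K V V (\<lambda>x. x)"
  by (simp add: linear_map_def)

lemma linear_map_tens_left:
  assumes "linear_map K Z X f" "y \<in> carrier Y" "module K X" "module K Y"
  shows "linear_map K Z (tensor_space K X Y) (\<lambda>z. tens K X Y (f z) y)"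
  using bilinear_map_tens[OF assms(3,4)] assms(2)
  by (intro linear_map_compose[OF _ assms(1)]) (simp add: bilinear_map_def)

lemma linear_map_tens_right:
  assumes "linear_map K Z Y f" "x \<in> carrier X" "module K X" "module K Y"
  shows "linear_map K Z (tensor_space K X Y) (\<lambda>z. tens K X Y x (f z))"
  using bilinear_map_tens[OF assms(3,4)] assms(2)
  by (intro linear_map_compose[OF _ assms(1)]) (simp add: bilinear_map_def)

lemma linear_map_sweedler_arg:
  assumes "linear_map K Z (tensor_space K V W) f" "bilinear_map K V W U \<beta>"
    "module K V" "module K W" "module K U"
  shows "linear_map K Z U (\<lambda>z. sweedler K U (f z) \<beta>)"
  by (rule linear_map_compose[OF linear_map_sweedler assms(1)]) fact+

lemma linear_map_smult_vector:
  assumes "linear_map K Z U f" "c \<in> carrier K" "module K U"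
  shows "linear_map K Z U (\<lambda>z. c \<odot>\<^bsub>U\<^esub> f z)"
proof -
  interpret U: module K U by fact
  show ?thesis using assms(2)
    by (intro linear_mapI)
       (simp_all add: linear_mapD[OF assms(1)] U.smult_r_distr U.smult_assoc1[symmetric] U.m_comm)
qed

lemma linear_map_smult_scalar:
  assumes "linear_map K Z (field_as_module K) f" "u \<in> carrier U" "module K U"
  shows "linear_map K Z U (\<lambda>z. f z \<odot>\<^bsub>U\<^esub> u)"
proof -
  interpret U: module K U by fact
  have "linear_map K (field_as_module K) U (\<lambda>c. c \<odot>\<^bsub>U\<^esub> u)"
    using assms(2) by (intro linear_mapI) (simp_all add: field_as_module_def U.smult_l_distr U.smult_assoc1)
  then show ?thesis by (rule linear_map_compose) fact
qed

lemma linear_map_field_mult_left: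
  assumes "linear_map K Z (field_as_module K) f" "c \<in> carrier K" "cring K"
  shows "linear_map K Z (field_as_module K) (\<lambda>z. f z \<otimes>\<^bsub>K\<^esub> c)"
proof -
  interpret cring K by fact
  have "linear_map K (field_as_module K) (field_as_module K) (\<lambda>x. x \<otimes>\<^bsub>K\<^esub> c)"
    using assms(2) by (intro linear_mapI) (simp_all add: field_as_module_def l_distr m_assoc)
  then show ?thesis by (rule linear_map_compose) fact
qed

lemma linear_map_field_mult_right:
  assumes "linear_map K Z (field_as_module K) f" "c \<in> carrier K" "cring K"
  shows "linear_map K Z (field_as_module K) (\<lambda>z. c \<otimes>\<^bsub>K\<^esub> f z)"
  using linear_map_smult_vector[OF assms(1,2) field_as_module_module[OF assms(3)]]
  by (simp add: field_as_module_def)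

lemma linear_map_mult_left:
  assumes "linear_map K Z A f" "a \<in> carrier A" "assoc_algebra K A"
  shows "linear_map K Z A (\<lambda>z. f z \<otimes>\<^bsub>A\<^esub> a)"
proof -
  interpret assoc_algebra K A by fact
  have "linear_map K A A (\<lambda>x. x \<otimes>\<^bsub>A\<^esub> a)"
    using assms(2) by (intro linear_mapI) (simp_all add: l_distr smult_mult_left)
  then show ?thesis by (rule linear_map_compose) fact
qed

lemma linear_map_mult_right:
  assumes "linear_map K Z A f" "a \<in> carrier A" "assoc_algebra K A"
  shows "linear_map K Z A (\<lambda>z. a \<otimes>\<^bsub>A\<^esub> f z)"
proof -
  interpret assoc_algebra K A by fact
  have "linear_map K A A (\<lambda>x. a \<otimes>\<^bsub>A\<^esub> x)"
    using assms(2) by (intro linear_mapI) (simp_all add: r_distr smult_mult_right)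
  then show ?thesis by (rule linear_map_compose) fact
qed

lemma bilinear_map_left:
  assumes "bilinear_map K U V W \<beta>" "linear_map K Z U f" "v \<in> carrier V"
  shows "linear_map K Z W (\<lambda>z. \<beta> (f z) v)"
  using assms(1,3) by (intro linear_map_compose[OF _ assms(2)]) (simp add: bilinear_map_def)

lemma bilinear_map_right:
  assumes "bilinear_map K U V W \<beta>" "linear_map K Z V f" "u \<in> carrier U"
  shows "linear_map K Z W (\<lambda>z. \<beta> u (f z))"
  using assms(1,3) by (intro linear_map_compose[OF _ assms(2)]) (simp add: bilinear_map_def)

lemma tens_smult_left:
  assumes "module K V" "module K W" "c \<in> carrier K" "v \<in> carrier V" "w \<in> carrier W"
  shows "tens K V W (c \<odot>\<^bsub>V\<^esub> v) w = c \<odot>\<^bsub>tensor_space K V W\<^esub> tens K V W v w"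
  using bilinear_map_tens[OF assms(1,2)] assms by (auto simp: bilinear_map_def linear_map_def)

lemma tens_smult_right:
  assumes "module K V" "module K W" "c \<in> carrier K" "v \<in> carrier V" "w \<in> carrier W"
  shows "tens K V W v (c \<odot>\<^bsub>W\<^esub> w) = c \<odot>\<^bsub>tensor_space K V W\<^esub> tens K V W v w"
  using bilinear_map_tens[OF assms(1,2)] assms by (auto simp: bilinear_map_def linear_map_def)

text \<open>
  Sweedler notation for \<open>\<Delta>(f(c)) = f(c\<^sub>(\<^sub>1\<^sub>)) \<otimes> f(c\<^sub>(\<^sub>2\<^sub>))\<close>, in a form that can be applied inside any
  bilinear expression.
\<close>

lemma sweedler_coalgebra_map:
  assumes f: "coalgebra_map K C D f" and mod: "module K C" "module K D" "module K U"
    and c: "c \<in> carrier C" "comult C c \<in> carrier (tensor_space K C C)"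
    and \<beta>: "bilinear_map K D D U \<beta>"
  shows "sweedler K U (comult D (f c)) \<beta> = sweedler K U (comult C c) (\<lambda>c1 c2. \<beta> (f c1) (f c2))"
proof -
  have lin: "linear_map K C D f" using f by (simp add: coalgebra_map_def)
  note rules = mod c \<beta> lin linear_map_id linear_map_compose[OF lin] linear_mapD(1)[OF lin] bilinear_mapI
    linear_map_tens_left linear_map_tens_right bilinear_map_left[OF \<beta>] bilinear_map_right[OF \<beta>]
  have "sweedler K U (comult D (f c)) \<beta> =
      sweedler K U (sweedler K (tensor_space K D D) (comult C c) (\<lambda>c1 c2. tens K D D (f c1) (f c2))) \<beta>"
    using f c by (simp add: coalgebra_map_def)
  also have "\<dots> = sweedler K U (comult C c) (\<lambda>c1 c2. sweedler K U (tens K D D (f c1) (f c2)) \<beta>)"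
    by (rule sweedler_sweedler, (assumption | rule rules)+)
  also have "\<dots> = sweedler K U (comult C c) (\<lambda>c1 c2. \<beta> (f c1) (f c2))"
    by (rule sweedler_cong[symmetric], (assumption | rule rules sweedler_tens[symmetric])+)
  finally show ?thesis .
qed

lemma (in coalgebra) counit_closed: "c \<in> carrier C \<Longrightarrow> counit C c \<in> carrier K"
  using linear_mapD(1)[OF counit_linear] by (simp add: field_as_module_def)

lemmas (in coalgebra) comult_closed = linear_mapD(1)[OF comult_linear]

section \<open>Monoids of maps and their units\<close>

lemma monoid_of_maps:
  assumes C: "\<And>F. F \<in> C \<Longrightarrow> F \<in> extensional S \<and> F \<in> S \<rightarrow> S"
    and id: "(\<lambda>x\<in>S. x) \<in> C"
    and comp: "\<And>F G. F \<in> C \<Longrightarrow> G \<in> C \<Longrightarrow> compose S F G \<in> C"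
  shows "monoid \<lparr>carrier = C, mult = compose S, one = (\<lambda>x\<in>S. x)\<rparr>"
proof (rule monoidI; simp)
  fix F assume "F \<in> C"
  with C have F: "F \<in> extensional S" "F \<in> S \<rightarrow> S" by auto
  show "compose S (\<lambda>x\<in>S. x) F = F" "compose S F (\<lambda>x\<in>S. x) = F"
    using F by (auto intro!: extensionalityI[of _ S] simp: compose_def)
next
  fix F G L assume "F \<in> C" "G \<in> C" "L \<in> C"
  then show "compose S (compose S F G) L = compose S F (compose S G L)"
    using C by (intro compose_assoc[symmetric]) auto
qed (use id comp in auto)

text \<open>
  An inverse in the monoid is an inverse map, which gives bijectivity; conversely the inverse of a
  bijection is a unit as soon as it lies in \<open>C\<close>, which is what the second assumption provides.
\<close>

lemma units_monoid_of_maps: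
  assumes C: "\<And>F. F \<in> C \<Longrightarrow> F \<in> extensional S \<and> F \<in> S \<rightarrow> S"
    and inv: "\<And>F G. F \<in> C \<Longrightarrow> G \<in> extensional S \<Longrightarrow> G \<in> S \<rightarrow> S \<Longrightarrow>
      (\<And>x. x \<in> S \<Longrightarrow> G (F x) = x) \<Longrightarrow> (\<And>x. x \<in> S \<Longrightarrow> F (G x) = x) \<Longrightarrow> G \<in> C"
  shows "Units \<lparr>carrier = C, mult = compose S, one = (\<lambda>x\<in>S. x)\<rparr> = {F \<in> C. bij_betw F S S}"
    (is "Units ?M = ?R")
proof (intro equalityI subsetI)
  fix F assume "F \<in> Units ?M"
  then obtain G where FG: "F \<in> C" "G \<in> C" "compose S G F = (\<lambda>x\<in>S. x)" "compose S F G = (\<lambda>x\<in>S. x)"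
    by (auto simp: Units_def)
  have "G (F x) = x" "F (G x) = x" if "x \<in> S" for x
    using FG(3,4)[THEN fun_cong, of x] that by (simp_all add: compose_def)
  then have "bij_betw F S S"
    using C[OF FG(1)] C[OF FG(2)] by (intro bij_betwI[of F S S G]) auto
  then show "F \<in> ?R" using FG by simp
next
  fix F assume "F \<in> ?R"
  then have F: "F \<in> C" "bij_betw F S S" by auto
  let ?G = "restrict (inv_into S F) S"
  have G: "?G \<in> S \<rightarrow> S" "\<And>x. x \<in> S \<Longrightarrow> ?G (F x) = x" "\<And>x. x \<in> S \<Longrightarrow> F (?G x) = x"
    using F(2) by (auto simp: bij_betw_def inv_into_into f_inv_into_f)
  have "?G \<in> C" by (rule inv[OF F(1) restrict_extensional G])
  moreover have "compose S ?G F = (\<lambda>x\<in>S. x)" "compose S F ?G = (\<lambda>x\<in>S. x)"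
    using G by (auto simp: compose_def restrict_def fun_eq_iff)
  ultimately show "F \<in> Units ?M" using F(1) unfolding Units_def by (auto intro!: bexI[of _ ?G])
qed

text \<open>
  A homomorphism in the sense of \<^const>\<open>hom\<close> respects products only. That the neutral elements
  correspond follows from surjectivity, after which invertibility is both preserved and reflected.
\<close>

lemma iso_units_of:
  assumes "monoid G" "monoid M" and \<phi>: "\<phi> \<in> iso G M"
  shows "\<phi> \<in> iso (units_of G) (units_of M)"
proof -
  interpret G: monoid G by fact
  interpret M: monoid M by fact
  have bij: "bij_betw \<phi> (carrier G) (carrier M)" and
    hom: "\<And>x y. x \<in> carrier G \<Longrightarrow> y \<in> carrier G \<Longrightarrow> \<phi> (x \<otimes>\<^bsub>G\<^esub> y) = \<phi> x \<otimes>\<^bsub>M\<^esub> \<phi> y"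
    and cl: "\<And>x. x \<in> carrier G \<Longrightarrow> \<phi> x \<in> carrier M"
    using \<phi> by (auto simp: iso_def hom_def)
  have surj: "\<exists>x\<in>carrier G. \<phi> x = y" if "y \<in> carrier M" for y
    using bij that unfolding bij_betw_def by (metis imageE)
  have inj: "x = y" if "\<phi> x = \<phi> y" "x \<in> carrier G" "y \<in> carrier G" for x y
    using bij that by (auto simp: bij_betw_def inj_on_def)
  have one: "\<phi> \<one>\<^bsub>G\<^esub> = \<one>\<^bsub>M\<^esub>"
  proof -
    obtain e where e: "e \<in> carrier G" "\<phi> e = \<one>\<^bsub>M\<^esub>" using surj by blast
    have "\<phi> \<one>\<^bsub>G\<^esub> = \<phi> \<one>\<^bsub>G\<^esub> \<otimes>\<^bsub>M\<^esub> \<phi> e" using e cl by simp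
    also have "\<dots> = \<phi> (\<one>\<^bsub>G\<^esub> \<otimes>\<^bsub>G\<^esub> e)" using e by (intro hom[symmetric]) auto
    also have "\<dots> = \<one>\<^bsub>M\<^esub>" using e by simp
    finally show ?thesis .
  qed
  have units: "\<phi> x \<in> Units M \<longleftrightarrow> x \<in> Units G" if x: "x \<in> carrier G" for x
  proof
    assume "x \<in> Units G"
    then obtain y where "y \<in> carrier G" "y \<otimes>\<^bsub>G\<^esub> x = \<one>\<^bsub>G\<^esub>" "x \<otimes>\<^bsub>G\<^esub> y = \<one>\<^bsub>G\<^esub>" by (auto simp: Units_def)
    then show "\<phi> x \<in> Units M" using x cl one hom unfolding Units_def by (metis (mono_tags, lifting) mem_Collect_eq)
  next
    assume "\<phi> x \<in> Units M"
    then obtain z where z: "z \<in> carrier M" "z \<otimes>\<^bsub>M\<^esub> \<phi> x = \<one>\<^bsub>M\<^esub>" "\<phi> x \<otimes>\<^bsub>M\<^esub> z = \<one>\<^bsub>M\<^esub>" by (auto simp: Units_def)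
    then obtain y where y: "y \<in> carrier G" "\<phi> y = z" using surj by blast
    have "y \<otimes>\<^bsub>G\<^esub> x = \<one>\<^bsub>G\<^esub>" "x \<otimes>\<^bsub>G\<^esub> y = \<one>\<^bsub>G\<^esub>"
      using x y z one by (auto intro!: inj simp: hom)
    then show "x \<in> Units G" using x y by (auto simp: Units_def)
  qed
  have "bij_betw \<phi> (Units G) (Units M)"
    unfolding bij_betw_def
  proof
    show "inj_on \<phi> (Units G)" using inj by (auto simp: inj_on_def Units_def)
    show "\<phi> ` Units G = Units M"
    proof (intro equalityI subsetI)
      fix y assume y: "y \<in> Units M"
      then obtain x where "x \<in> carrier G" "\<phi> x = y" using surj[OF M.Units_closed] by blast
      then show "y \<in> \<phi> ` Units G" using units y by blast
    next
      fix y assume "y \<in> \<phi> ` Units G"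
      then show "y \<in> Units M" using units[OF G.Units_closed] by blast
    qed
  qed
  moreover have "\<phi> \<in> hom (units_of G) (units_of M)"
    using units[OF G.Units_closed] hom[OF G.Units_closed G.Units_closed]
    by (intro homI) (simp_all add: units_of_carrier units_of_mult)
  ultimately show ?thesis by (simp add: iso_def units_of_carrier)
qed

section \<open>Monoids of Hopf maps\<close>

text \<open>
  The common ground of \<open>B\<close>, which is a Hopf algebra only in the braided sense, and the biproduct:
  on such a structure, composites and inverses of Hopf maps are again Hopf maps.
\<close>

locale bialgebra_structure = module K A for K and A :: "('k, 'a, 'e) bialg_scheme" (structure) +
  assumes one_closed: "\<one>\<^bsub>A\<^esub> \<in> carrier A"
    and mult_closed: "x \<in> carrier A \<Longrightarrow> y \<in> carrier A \<Longrightarrow> x \<otimes>\<^bsub>A\<^esub> y \<in> carrier A"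
    and comult_closed: "x \<in> carrier A \<Longrightarrow> comult A x \<in> carrier (tensor_space K A A)"
begin

lemma hopf_mapD:
  assumes "hopf_map K A A f"
  shows "linear_map K A A f" "coalgebra_map K A A f" "f \<in> carrier A \<rightarrow> carrier A"
    "f \<one>\<^bsub>A\<^esub> = \<one>\<^bsub>A\<^esub>"
    "\<And>x y. x \<in> carrier A \<Longrightarrow> y \<in> carrier A \<Longrightarrow> f (x \<otimes>\<^bsub>A\<^esub> y) = f x \<otimes>\<^bsub>A\<^esub> f y"
    "\<And>x. x \<in> carrier A \<Longrightarrow> counit A (f x) = counit A x"
    "\<And>x. x \<in> carrier A \<Longrightarrow> comult A (f x) =
      sweedler K (tensor_space K A A) (comult A x) (\<lambda>x1 x2. tens K A A (f x1) (f x2))"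
  using assms by (auto simp: hopf_map_def algebra_map_def coalgebra_map_def ring_hom_def linear_map_def)

lemma hopf_mapI:
  assumes "linear_map K A A f" "f \<one>\<^bsub>A\<^esub> = \<one>\<^bsub>A\<^esub>"
    "\<And>x y. x \<in> carrier A \<Longrightarrow> y \<in> carrier A \<Longrightarrow> f (x \<otimes>\<^bsub>A\<^esub> y) = f x \<otimes>\<^bsub>A\<^esub> f y"
    "\<And>x. x \<in> carrier A \<Longrightarrow> counit A (f x) = counit A x"
    "\<And>x. x \<in> carrier A \<Longrightarrow> comult A (f x) =
      sweedler K (tensor_space K A A) (comult A x) (\<lambda>x1 x2. tens K A A (f x1) (f x2))"
  shows "hopf_map K A A f"
  using assms by (auto simp: hopf_map_def algebra_map_def coalgebra_map_def ring_hom_def linear_map_def)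

lemmas tens_rules = module_axioms tensor_space_module linear_map_id bilinear_mapI
  linear_map_tens_left linear_map_tens_right comult_closed

text \<open>
  Endomorphisms are normalised to be extensional, while the maps that arise naturally are not; this
  lemma passes from one to the other.
\<close>

lemma hopf_map_cong:
  assumes f: "hopf_map K A A f" and eq: "\<And>x. x \<in> carrier A \<Longrightarrow> f x = g x"
  shows "hopf_map K A A g"
proof (rule hopf_mapI)
  note D = hopf_mapD[OF f]
  show "linear_map K A A g" by (rule linear_map_cong[OF module_axioms D(1) eq])
  fix x assume x: "x \<in> carrier A"
  have "comult A (g x) =
      sweedler K (tensor_space K A A) (comult A x) (\<lambda>x1 x2. tens K A A (f x1) (f x2))"
    using x D by (simp flip: eq)
  also have "\<dots> = sweedler K (tensor_space K A A) (comult A x) (\<lambda>x1 x2. tens K A A (g x1) (g x2))"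
    by (rule sweedler_cong, (assumption | rule x tens_rules linear_map_compose[OF D(1)] linear_mapD(1)[OF D(1)])+)
       (simp add: eq)
  finally show "comult A (g x) =
      sweedler K (tensor_space K A A) (comult A x) (\<lambda>x1 x2. tens K A A (g x1) (g x2))" .
qed (use hopf_mapD[OF f] in \<open>simp_all add: eq[symmetric] one_closed mult_closed\<close>)

lemma hopf_map_id: "hopf_map K A A (\<lambda>x. x)"
  by (rule hopf_mapI)
     (simp_all add: linear_map_id sweedler_self[OF comult_closed module_axioms module_axioms])

lemma hopf_map_comp:
  assumes g: "hopf_map K A A g" and f: "hopf_map K A A f"
  shows "hopf_map K A A (\<lambda>x. g (f x))"
proof (rule hopf_mapI)
  note G = hopf_mapD[OF g] and F = hopf_mapD[OF f]
  show "linear_map K A A (\<lambda>x. g (f x))" by (rule linear_map_compose[OF G(1) F(1)])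
  fix x assume x: "x \<in> carrier A"
  have "comult A (g (f x)) =
      sweedler K (tensor_space K A A) (comult A (f x)) (\<lambda>x1 x2. tens K A A (g x1) (g x2))"
    using F(3) x by (intro G(7)) auto
  also have "\<dots> = sweedler K (tensor_space K A A) (comult A x) (\<lambda>x1 x2. tens K A A (g (f x1)) (g (f x2)))"
    by (rule sweedler_coalgebra_map[OF F(2)],
        (assumption | rule x tens_rules linear_map_compose[OF G(1)] linear_mapD(1)[OF G(1)])+)
  finally show "comult A (g (f x)) =
      sweedler K (tensor_space K A A) (comult A x) (\<lambda>x1 x2. tens K A A (g (f x1)) (g (f x2)))" .
  show "counit A (g (f x)) = counit A x" using x F(3) by (simp add: F(6) G(6) Pi_iff)
qed (use hopf_mapD[OF f] hopf_mapD[OF g] in \<open>auto simp: Pi_iff\<close>)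

text \<open>
  For the coproduct: \<open>\<Delta>(g(x)) = g(f(g(x)\<^sub>(\<^sub>1\<^sub>))) \<otimes> g(f(g(x)\<^sub>(\<^sub>2\<^sub>)))\<close>, and as \<open>f\<close> is a coalgebra map this is
  \<open>g \<otimes> g\<close> applied to \<open>\<Delta>(f(g(x))) = \<Delta>(x)\<close>.
\<close>

lemma hopf_map_inverse:
  assumes f: "hopf_map K A A f" and g: "g \<in> carrier A \<rightarrow> carrier A"
    and gf: "\<And>x. x \<in> carrier A \<Longrightarrow> g (f x) = x" and fg: "\<And>x. x \<in> carrier A \<Longrightarrow> f (g x) = x"
  shows "hopf_map K A A g"
proof (rule hopf_mapI)
  note F = hopf_mapD[OF f]
  have gc: "g x \<in> carrier A" if "x \<in> carrier A" for x using g that by auto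
  show lin: "linear_map K A A g"
  proof (rule linear_mapI)
    fix x y assume xy: "x \<in> carrier A" "y \<in> carrier A"
    \<comment> \<open>As for the other operations, apply \<open>f\<close> to the right-hand side of the claim and then \<open>g\<close> to the result.\<close>
    have "f (g x \<oplus>\<^bsub>A\<^esub> g y) = x \<oplus>\<^bsub>A\<^esub> y" using xy by (simp add: linear_mapD[OF F(1)] gc fg)
    then show "g (x \<oplus>\<^bsub>A\<^esub> y) = g x \<oplus>\<^bsub>A\<^esub> g y" using gf[of "g x \<oplus>\<^bsub>A\<^esub> g y"] xy gc by simp
  next
    fix c x assume cx: "c \<in> carrier K" "x \<in> carrier A"
    have "f (c \<odot>\<^bsub>A\<^esub> g x) = c \<odot>\<^bsub>A\<^esub> x" using cx by (simp add: linear_mapD[OF F(1)] gc fg)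
    then show "g (c \<odot>\<^bsub>A\<^esub> x) = c \<odot>\<^bsub>A\<^esub> g x" using gf[of "c \<odot>\<^bsub>A\<^esub> g x"] cx gc by simp
  qed (rule gc)
  show "g \<one>\<^bsub>A\<^esub> = \<one>\<^bsub>A\<^esub>" using gf[OF one_closed] F(4) by simp
  show "g (x \<otimes>\<^bsub>A\<^esub> y) = g x \<otimes>\<^bsub>A\<^esub> g y" if "x \<in> carrier A" "y \<in> carrier A" for x y
    using gf[of "g x \<otimes>\<^bsub>A\<^esub> g y"] F(5)[of "g x" "g y"] that gc fg mult_closed by simp
  fix x assume x: "x \<in> carrier A"
  show "counit A (g x) = counit A x" using F(6)[OF gc[OF x]] x by (simp add: fg)
  note rules = gc x tens_rules linear_map_compose[OF lin] linear_map_compose[OF F(1)] linear_mapD(1)[OF F(1)]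
  have "comult A (g x) = sweedler K (tensor_space K A A) (comult A (g x)) (tens K A A)"
    by (rule sweedler_self[symmetric], (assumption | rule rules)+)
  also have "\<dots> = sweedler K (tensor_space K A A) (comult A (g x))
      (\<lambda>x1 x2. tens K A A (g (f x1)) (g (f x2)))"
    by (rule sweedler_cong, (assumption | rule rules)+) (simp add: gf)
  also have "\<dots> = sweedler K (tensor_space K A A) (comult A (f (g x)))
      (\<lambda>x1 x2. tens K A A (g x1) (g x2))"
    by (rule sweedler_coalgebra_map[OF F(2), symmetric], (assumption | rule rules)+)
  finally show "comult A (g x) =
      sweedler K (tensor_space K A A) (comult A x) (\<lambda>x1 x2. tens K A A (g x1) (g x2))"
    using x by (simp add: fg)
qed

lemma End_Hopf_iff:
  "F \<in> carrier (End_Hopf K H A p j) \<longleftrightarrow> F \<in> extensional (carrier A) \<and> hopf_map K A A F \<and>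
    (\<forall>a\<in>carrier A. p (F a) = p a) \<and> (\<forall>h\<in>carrier H. F (j h) = j h)"
  by (simp add: End_Hopf_def)

lemma End_Hopf_eq:
  "End_Hopf K H A p j = \<lparr>carrier = carrier (End_Hopf K H A p j),
    mult = compose (carrier A), one = (\<lambda>a\<in>carrier A. a)\<rparr>"
  by (simp add: End_Hopf_def)

lemma End_Hopf_maps:
  "F \<in> carrier (End_Hopf K H A p j) \<Longrightarrow> F \<in> extensional (carrier A) \<and> F \<in> carrier A \<rightarrow> carrier A"
  unfolding End_Hopf_iff using hopf_mapD(3) by blast

lemma monoid_End_Hopf:
  assumes j: "j \<in> carrier H \<rightarrow> carrier A"
  shows "monoid (End_Hopf K H A p j)"
proof -
  have "monoid \<lparr>carrier = carrier (End_Hopf K H A p j),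
    mult = compose (carrier A), one = (\<lambda>a\<in>carrier A. a)\<rparr>"
  proof (rule monoid_of_maps[OF End_Hopf_maps])
    show "(\<lambda>a\<in>carrier A. a) \<in> carrier (End_Hopf K H A p j)"
      unfolding End_Hopf_iff using j by (auto intro: hopf_map_cong[OF hopf_map_id])
    fix F G assume "F \<in> carrier (End_Hopf K H A p j)" "G \<in> carrier (End_Hopf K H A p j)"
    note FG = this[unfolded End_Hopf_iff]
    then have "hopf_map K A A F" "hopf_map K A A G" by blast+
    then have "hopf_map K A A (compose (carrier A) F G)"
      by (rule hopf_map_cong[OF hopf_map_comp]) (simp add: compose_def)
    moreover have "p (compose (carrier A) F G a) = p a" if a: "a \<in> carrier A" for a
    proof -
      have "G a \<in> carrier A" using FG(2) a hopf_mapD(3) by blast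
      then have "p (F (G a)) = p (G a)" using FG(1) by blast
      also have "\<dots> = p a" using FG(2) a by blast
      finally show ?thesis using a by (simp add: compose_def)
    qed
    moreover have "compose (carrier A) F G (j h) = j h" if h: "h \<in> carrier H" for h
    proof -
      have "j h \<in> carrier A" "F (j h) = j h" "G (j h) = j h" using FG h j by blast+
      then show ?thesis by (simp add: compose_def)
    qed
    ultimately show "compose (carrier A) F G \<in> carrier (End_Hopf K H A p j)"
      unfolding End_Hopf_iff by (simp add: compose_def)
  qed
  then show ?thesis by (simp flip: End_Hopf_eq)
qed

lemma Aut_Hopf_eq_units:
  assumes j: "j \<in> carrier H \<rightarrow> carrier A"
  shows "Aut_Hopf K H A p j = units_of (End_Hopf K H A p j)"
proof -
  have "Units \<lparr>carrier = carrier (End_Hopf K H A p j), mult = compose (carrier A), one = (\<lambda>a\<in>carrier A. a)\<rparr> =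
    {F \<in> carrier (End_Hopf K H A p j). bij_betw F (carrier A) (carrier A)}"
  proof (rule units_monoid_of_maps[OF End_Hopf_maps])
    fix F G
    assume "F \<in> carrier (End_Hopf K H A p j)"
      and G: "G \<in> extensional (carrier A)" "G \<in> carrier A \<rightarrow> carrier A"
        "\<And>x. x \<in> carrier A \<Longrightarrow> G (F x) = x" "\<And>x. x \<in> carrier A \<Longrightarrow> F (G x) = x"
    note F = this(1)[unfolded End_Hopf_iff]
    have "hopf_map K A A F" using F by blast
    then have "hopf_map K A A G" by (rule hopf_map_inverse[OF _ G(2-4)])
    moreover have "p (G a) = p a" if "a \<in> carrier A" for a
    proof -
      have "p (F (G a)) = p (G a)" using F G(2) that by auto
      then show ?thesis using G(4)[OF that] by simp
    qed
    moreover have "G (j h) = j h" if "h \<in> carrier H" for h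
      using F G(3)[of "j h"] j that by auto
    ultimately show "G \<in> carrier (End_Hopf K H A p j)" unfolding End_Hopf_iff using G(1) by blast
  qed
  then have "Units (End_Hopf K H A p j) =
      {F \<in> carrier (End_Hopf K H A p j). bij_betw F (carrier A) (carrier A)}"
    by (simp flip: End_Hopf_eq)
  then show ?thesis by (simp add: Aut_Hopf_def units_of_def End_Hopf_def)
qed

end

section \<open>Structure maps of the biproduct\<close>

context yd_hopf_algebra
begin

abbreviation T where "T \<equiv> tensor_space K B H"
abbreviation A where "A \<equiv> biproduct K H B"
abbreviation pure_tensor (infixl "\<ltimes>" 65) where "b \<ltimes> h \<equiv> tens K B H b h"

lemmas module_T = tensor_space_module[OF B.module_axioms H.module_axioms]

lemma linear_map_action_left:
  assumes "linear_map K Z H f" "b \<in> carrier B"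
  shows "linear_map K Z B (\<lambda>z. action B (f z) b)"
  using action_bilinear assms(2)
  by (intro linear_map_compose[OF _ assms(1)]) (simp add: bilinear_map_def)

lemma linear_map_action_right:
  assumes "linear_map K Z B f" "h \<in> carrier H"
  shows "linear_map K Z B (\<lambda>z. action B h (f z))"
  using action_bilinear assms(2)
  by (intro linear_map_compose[OF _ assms(1)]) (simp add: bilinear_map_def)

text \<open>
  All Sweedler expressions below are linear in each bound variable because the variable occurs exactly
  once in them. These rules derive linearity, bilinearity and membership in carriers by following the
  syntax of the expression. The spaces over which an inner sum ranges are not visible in that
  syntax; they are determined by the premise on the tensor summed over, which therefore comes first
  in the rules for \<^const>\<open>sweedler\<close>.
\<close>

lemmas multilinear =
  linear_map_id bilinear_mapI
  linear_map_tens_left linear_map_tens_right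
  linear_map_sweedler_arg linear_map_sweedler_body
  linear_map_smult_scalar linear_map_smult_vector
  linear_map_field_mult_left linear_map_field_mult_right
  linear_map_mult_left linear_map_mult_right
  linear_map_action_left linear_map_action_right
  linear_map_compose[OF B.comult_linear] linear_map_compose[OF H.comult_linear]
  linear_map_compose[OF B.counit_linear] linear_map_compose[OF H.counit_linear]
  linear_map_compose[OF coaction_linear]
  tens_carrier sweedler_closed B.comult_closed H.comult_closed B.counit_closed H.counit_closed
  linear_mapD(1)[OF coaction_linear] bilinear_map_closed[OF action_bilinear]
  B.m_closed H.m_closed H.R.m_closed B.one_closed H.one_closed B.smult_closed H.smult_closed
  B.module_axioms H.module_axioms tensor_space_module field_as_module_module H.R.is_cring
  B.assoc_algebra_axioms H.assoc_algebra_axioms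

text \<open>
  As a module the biproduct is \<open>B \<otimes> H\<close>, but it is a different record. The following facts translate
  everything that is built from the module structure alone into terms of \<open>T\<close>.
\<close>

lemma biproduct_simps:
  "carrier A = carrier T" "\<one>\<^bsub>A\<^esub> = \<one>\<^bsub>B\<^esub> \<ltimes> \<one>\<^bsub>H\<^esub>" "\<zero>\<^bsub>A\<^esub> = \<zero>\<^bsub>T\<^esub>" "add A = add T" "smult A = smult T"
  by (simp_all add: biproduct_def Let_def)

lemma linear_map_biproduct: "linear_map K A A F \<longleftrightarrow> linear_map K T T F"
  by (simp add: linear_map_def biproduct_simps)

lemma tensor_space_biproduct: "tensor_space K A A = tensor_space K T T"
  by (simp add: tensor_space_def tensor_relations_def tensor_generators_def biproduct_simps)

lemma tens_biproduct: "tens K A A = tens K T T"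
  by (simp add: fun_eq_iff tens_def tensor_relations_def tensor_generators_def biproduct_simps)

lemma sweedler_biproduct: "sweedler K A = sweedler K T"
  by (simp add: fun_eq_iff sweedler_def Let_def finsum_def finprod_def biproduct_simps)

lemma biproduct_module: "module K A"
proof -
  interpret T: module K T by (rule module_T)
  have "abelian_group A"
    by (rule abelian_groupI)
       (auto simp: biproduct_simps T.M.a_ac intro: bexI[of _ "\<ominus>\<^bsub>T\<^esub> _"] T.M.l_neg)
  then show ?thesis
    by (intro moduleI)
       (auto simp: biproduct_simps H.R.is_cring T.smult_l_distr T.smult_r_distr T.smult_assoc1)
qed

lemma linear_map_biproduct_mult_left:
  assumes "linear_map K Z T f" "t \<in> carrier T" "module K Z"
  shows "linear_map K Z T (\<lambda>z. f z \<otimes>\<^bsub>A\<^esub> t)"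
  unfolding biproduct_def Let_def monoid.simps
  by (assumption | rule assms linear_mapD(1)[OF assms(1)] multilinear)+

lemma linear_map_biproduct_mult_right:
  assumes "linear_map K Z T f" "s \<in> carrier T" "module K Z"
  shows "linear_map K Z T (\<lambda>z. s \<otimes>\<^bsub>A\<^esub> f z)"
  unfolding biproduct_def Let_def monoid.simps
  by (assumption | rule assms linear_mapD(1)[OF assms(1)] multilinear)+

lemma biproduct_comult_linear: "linear_map K T (tensor_space K T T) (comult A)"
  unfolding biproduct_def Let_def bialg.simps
  by (assumption | rule multilinear)+

lemma biproduct_counit_linear: "linear_map K T (field_as_module K) (counit A)"
  unfolding biproduct_def Let_def bialg.simps
  by (assumption | rule multilinear)+

lemma biproduct_proj_linear: "linear_map K T H (biproduct_proj K H B)"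
  unfolding biproduct_proj_def
  by (assumption | rule multilinear)+


lemma biproduct_mult_pure:
  assumes "b \<in> carrier B" "h \<in> carrier H" "b' \<in> carrier B" "h' \<in> carrier H"
  shows "(b \<ltimes> h) \<otimes>\<^bsub>A\<^esub> (b' \<ltimes> h') =
    sweedler K T (comult H h) (\<lambda>h1 h2. (b \<otimes>\<^bsub>B\<^esub> action B h1 b') \<ltimes> (h2 \<otimes>\<^bsub>H\<^esub> h'))"
  unfolding biproduct_def Let_def monoid.simps
  by (rule trans, rule sweedler_tens, (assumption | rule assms multilinear)+,
      rule sweedler_tens, (assumption | rule assms multilinear)+)

lemma biproduct_comult_pure:
  assumes "b \<in> carrier B" "h \<in> carrier H"
  shows "comult A (b \<ltimes> h) =
    sweedler K (tensor_space K T T) (comult B b) (\<lambda>b1 b2.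
      sweedler K (tensor_space K T T) (coaction B b2) (\<lambda>x b20.
        sweedler K (tensor_space K T T) (comult H h) (\<lambda>h1 h2.
          tens K T T (b1 \<ltimes> (x \<otimes>\<^bsub>H\<^esub> h1)) (b20 \<ltimes> h2))))"
  unfolding biproduct_def Let_def bialg.simps
  by (rule sweedler_tens, (assumption | rule assms multilinear)+)

lemma biproduct_counit_pure:
  assumes "b \<in> carrier B" "h \<in> carrier H"
  shows "counit A (b \<ltimes> h) = counit B b \<otimes>\<^bsub>K\<^esub> counit H h"
  unfolding biproduct_def Let_def bialg.simps
  by (rule sweedler_tens, (assumption | rule assms multilinear)+)

lemma biproduct_proj_pure:
  assumes "b \<in> carrier B" "h \<in> carrier H"
  shows "biproduct_proj K H B (b \<ltimes> h) = counit B b \<odot>\<^bsub>H\<^esub> h"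
  unfolding biproduct_proj_def
  by (rule sweedler_tens, (assumption | rule assms multilinear)+)

text \<open>
  The map \<open>id \<otimes> \<epsilon>\<close> from \<open>A\<close> onto \<open>B\<close>, called \<open>P\<close> in the comments. Together with the projection \<open>\<pi> = \<epsilon> \<otimes> id\<close> onto \<open>H\<close> it takes
  the biproduct apart.
\<close>

definition base_proj where
  "base_proj t = sweedler K B t (\<lambda>b h. counit H h \<odot>\<^bsub>B\<^esub> b)"

lemma base_proj_linear: "linear_map K T B base_proj"
  unfolding base_proj_def by (assumption | rule multilinear)+

lemma base_proj_pure:
  assumes "b \<in> carrier B" "h \<in> carrier H"
  shows "base_proj (b \<ltimes> h) = counit H h \<odot>\<^bsub>B\<^esub> b"
  unfolding base_proj_def by (rule sweedler_tens, (assumption | rule assms multilinear)+)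

lemma base_proj_base: "b \<in> carrier B \<Longrightarrow> base_proj (b \<ltimes> \<one>\<^bsub>H\<^esub>) = b"
  by (simp add: base_proj_pure H.counit_one)

lemmas biproduct_multilinear = multilinear
  linear_map_compose[OF base_proj_linear] linear_mapD(1)[OF base_proj_linear]
  linear_map_compose[OF biproduct_proj_linear] linear_mapD(1)[OF biproduct_proj_linear]
  linear_map_compose[OF biproduct_comult_linear] linear_mapD(1)[OF biproduct_comult_linear]
  linear_map_compose[OF biproduct_counit_linear]
  linear_map_biproduct_mult_left linear_map_biproduct_mult_right

section \<open>Recovering the structure of \<open>B\<close> from the biproduct\<close>

lemma counit_base_proj:
  assumes "t \<in> carrier T" shows "counit B (base_proj t) = counit A t"
proof (rule tensor_ext[OF B.module_axioms H.module_axioms field_as_module_module _ _ _ assms])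
  fix b h assume "b \<in> carrier B" "h \<in> carrier H"
  then show "counit B (base_proj (b \<ltimes> h)) = counit A (b \<ltimes> h)"
    by (simp add: base_proj_pure biproduct_counit_pure linear_mapD(3)[OF B.counit_linear]
        H.counit_closed B.counit_closed H.R.m_comm)
       (simp add: field_as_module_def H.counit_closed B.counit_closed H.R.m_comm)
qed (assumption | rule biproduct_multilinear)+

text \<open>
  The coproduct \<open>(b\<^sub>(\<^sub>1\<^sub>) \<ltimes> b\<^sub>(\<^sub>2\<^sub>)\<^sub>(\<^sub>-\<^sub>1\<^sub>)h\<^sub>(\<^sub>1\<^sub>)) \<otimes> (b\<^sub>(\<^sub>2\<^sub>)\<^sub>(\<^sub>0\<^sub>) \<ltimes> h\<^sub>(\<^sub>2\<^sub>))\<close> in a form that can be applied inside any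
  bilinear expression.
\<close>

lemma sweedler_biproduct_comult:
  assumes b: "b \<in> carrier B" and h: "h \<in> carrier H"
    and U: "module K U" and \<beta>: "bilinear_map K T T U \<beta>"
  shows "sweedler K U (comult A (b \<ltimes> h)) \<beta> =
    sweedler K U (comult B b) (\<lambda>b1 b2.
      sweedler K U (coaction B b2) (\<lambda>x b20.
        sweedler K U (comult H h) (\<lambda>h1 h2. \<beta> (b1 \<ltimes> (x \<otimes>\<^bsub>H\<^esub> h1)) (b20 \<ltimes> h2))))"
  unfolding biproduct_comult_pure[OF b h]
  \<comment> \<open>One substitution for each of the three nested sums, then evaluation on a pure tensor.\<close>
  apply (rule trans, rule sweedler_sweedler, (assumption | rule assms multilinear)+)
  apply (rule sweedler_cong, (assumption | rule assms multilinear bilinear_map_left[OF \<beta>] bilinear_map_right[OF \<beta>])+)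
  apply (rule trans, rule sweedler_sweedler, (assumption | rule assms multilinear)+)
  apply (rule sweedler_cong, (assumption | rule assms multilinear bilinear_map_left[OF \<beta>] bilinear_map_right[OF \<beta>])+)
  apply (rule trans, rule sweedler_sweedler, (assumption | rule assms multilinear)+)
  apply (rule sweedler_cong, (assumption | rule assms multilinear bilinear_map_left[OF \<beta>] bilinear_map_right[OF \<beta>])+)
  apply (rule sweedler_tens, (assumption | rule assms multilinear)+)
  done

text \<open>
  For \<open>h = 1\<close> the sum over \<open>\<Delta>(1) = 1 \<otimes> 1\<close> disappears.
\<close>

lemma sweedler_biproduct_comult_base:
  assumes b: "b \<in> carrier B" and U: "module K U" and \<beta>: "bilinear_map K T T U \<beta>"
  shows "sweedler K U (comult A (b \<ltimes> \<one>\<^bsub>H\<^esub>)) \<beta> =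
    sweedler K U (comult B b) (\<lambda>b1 b2.
      sweedler K U (coaction B b2) (\<lambda>x b20. \<beta> (b1 \<ltimes> x) (b20 \<ltimes> \<one>\<^bsub>H\<^esub>)))"
proof -
  note rules = assms multilinear bilinear_map_left[OF \<beta>] bilinear_map_right[OF \<beta>]
  have inner: "sweedler K U (comult H \<one>\<^bsub>H\<^esub>) (\<lambda>h1 h2. \<beta> (b1 \<ltimes> (x \<otimes>\<^bsub>H\<^esub> h1)) (b20 \<ltimes> h2)) =
      \<beta> (b1 \<ltimes> x) (b20 \<ltimes> \<one>\<^bsub>H\<^esub>)"
    if "b1 \<in> carrier B" "x \<in> carrier H" "b20 \<in> carrier B" for b1 x b20
    unfolding H.comult_one
    by (rule trans, rule sweedler_tens, (assumption | rule that rules)+) (simp add: that)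
  show ?thesis
    unfolding sweedler_biproduct_comult[OF b H.one_closed U \<beta>]
    by (rule sweedler_cong, (assumption | rule rules)+)
       (rule sweedler_cong, (assumption | rule rules inner)+)
qed

text \<open>
  The first of three formulas which recover the structure of \<open>B\<close> from that of \<open>A\<close>. Here \<open>P\<close>
  turns the factor \<open>b\<^sub>(\<^sub>2\<^sub>)\<^sub>(\<^sub>-\<^sub>1\<^sub>)\<close> into its counit, and the counit law of the coaction removes it.
\<close>

lemma comult_base_proj:
  assumes b: "b \<in> carrier B"
  shows "sweedler K (tensor_space K B B) (comult A (b \<ltimes> \<one>\<^bsub>H\<^esub>))
    (\<lambda>a1 a2. tens K B B (base_proj a1) (base_proj a2)) = comult B b"
proof -
  have inner: "sweedler K (tensor_space K B B) (coaction B b2)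
      (\<lambda>x b20. tens K B B (base_proj (b1 \<ltimes> x)) (base_proj (b20 \<ltimes> \<one>\<^bsub>H\<^esub>))) = tens K B B b1 b2"
    if b12: "b1 \<in> carrier B" "b2 \<in> carrier B" for b1 b2
  proof -
    have "sweedler K (tensor_space K B B) (coaction B b2)
        (\<lambda>x b20. tens K B B (base_proj (b1 \<ltimes> x)) (base_proj (b20 \<ltimes> \<one>\<^bsub>H\<^esub>))) =
      sweedler K (tensor_space K B B) (coaction B b2) (\<lambda>x b20. tens K B B b1 (counit H x \<odot>\<^bsub>B\<^esub> b20))"
      by (rule sweedler_cong, (assumption | rule b12 biproduct_multilinear)+)
         (simp add: b12 base_proj_pure H.counit_one H.counit_closed
           tens_smult_left tens_smult_right B.module_axioms)
    also have "\<dots> = tens K B B b1 (sweedler K B (coaction B b2) (\<lambda>x b20. counit H x \<odot>\<^bsub>B\<^esub> b20))"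
      by (rule sweedler_linear[symmetric], (assumption | rule b12 biproduct_multilinear)+)
    finally show ?thesis by (simp add: coaction_counit b12)
  qed
  have "sweedler K (tensor_space K B B) (comult A (b \<ltimes> \<one>\<^bsub>H\<^esub>))
      (\<lambda>a1 a2. tens K B B (base_proj a1) (base_proj a2)) =
    sweedler K (tensor_space K B B) (comult B b) (\<lambda>b1 b2.
      sweedler K (tensor_space K B B) (coaction B b2)
        (\<lambda>x b20. tens K B B (base_proj (b1 \<ltimes> x)) (base_proj (b20 \<ltimes> \<one>\<^bsub>H\<^esub>))))"
    by (rule sweedler_biproduct_comult_base, (assumption | rule b biproduct_multilinear)+)
  also have "\<dots> = sweedler K (tensor_space K B B) (comult B b) (tens K B B)"
    by (rule sweedler_cong, (assumption | rule b inner biproduct_multilinear)+)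
  also have "\<dots> = comult B b"
    by (rule sweedler_self, (assumption | rule b biproduct_multilinear)+)
  finally show ?thesis .
qed

text \<open>
  Here \<open>\<pi>\<close> turns \<open>b\<^sub>(\<^sub>1\<^sub>)\<close> into its counit, and the counit law of \<open>B\<close> removes it, leaving \<open>\<rho>(b)\<close>.
\<close>

lemma coaction_base_proj:
  assumes b: "b \<in> carrier B"
  shows "sweedler K (tensor_space K H B) (comult A (b \<ltimes> \<one>\<^bsub>H\<^esub>))
    (\<lambda>a1 a2. tens K H B (biproduct_proj K H B a1) (base_proj a2)) = coaction B b"
proof -
  have inner: "sweedler K (tensor_space K H B) (coaction B b2)
      (\<lambda>x b20. tens K H B (biproduct_proj K H B (b1 \<ltimes> x)) (base_proj (b20 \<ltimes> \<one>\<^bsub>H\<^esub>))) =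
      coaction B (counit B b1 \<odot>\<^bsub>B\<^esub> b2)"
    if b12: "b1 \<in> carrier B" "b2 \<in> carrier B" for b1 b2
  proof -
    have "sweedler K (tensor_space K H B) (coaction B b2)
        (\<lambda>x b20. tens K H B (biproduct_proj K H B (b1 \<ltimes> x)) (base_proj (b20 \<ltimes> \<one>\<^bsub>H\<^esub>))) =
      sweedler K (tensor_space K H B) (coaction B b2)
        (\<lambda>x b20. counit B b1 \<odot>\<^bsub>tensor_space K H B\<^esub> tens K H B x b20)"
      by (rule sweedler_cong, (assumption | rule b12 biproduct_multilinear)+)
         (simp add: b12 base_proj_base biproduct_proj_pure B.counit_closed
           tens_smult_left H.module_axioms B.module_axioms)
    also have "\<dots> = counit B b1 \<odot>\<^bsub>tensor_space K H B\<^esub>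
        sweedler K (tensor_space K H B) (coaction B b2) (tens K H B)"
      by (rule sweedler_linear[symmetric], (assumption | rule b12 biproduct_multilinear)+)
    also have "sweedler K (tensor_space K H B) (coaction B b2) (tens K H B) = coaction B b2"
      by (rule sweedler_self, (assumption | rule b12 biproduct_multilinear)+)
    finally show ?thesis
      by (simp add: linear_mapD(3)[OF coaction_linear] b12 B.counit_closed)
  qed
  have "sweedler K (tensor_space K H B) (comult A (b \<ltimes> \<one>\<^bsub>H\<^esub>))
      (\<lambda>a1 a2. tens K H B (biproduct_proj K H B a1) (base_proj a2)) =
    sweedler K (tensor_space K H B) (comult B b) (\<lambda>b1 b2.
      sweedler K (tensor_space K H B) (coaction B b2)
        (\<lambda>x b20. tens K H B (biproduct_proj K H B (b1 \<ltimes> x)) (base_proj (b20 \<ltimes> \<one>\<^bsub>H\<^esub>))))"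
    by (rule sweedler_biproduct_comult_base, (assumption | rule b biproduct_multilinear)+)
  also have "\<dots> = sweedler K (tensor_space K H B) (comult B b)
      (\<lambda>b1 b2. coaction B (counit B b1 \<odot>\<^bsub>B\<^esub> b2))"
    by (rule sweedler_cong, (assumption | rule b inner biproduct_multilinear)+)
  also have "\<dots> = coaction B (sweedler K B (comult B b) (\<lambda>b1 b2. counit B b1 \<odot>\<^bsub>B\<^esub> b2))"
    by (rule sweedler_linear[symmetric],
        (assumption | rule b coaction_linear biproduct_multilinear)+)
  finally show ?thesis by (simp add: B.counit_left b)
qed

text \<open>
  The product is \<open>h\<^sub>(\<^sub>1\<^sub>) \<cdot> b \<ltimes> h\<^sub>(\<^sub>2\<^sub>)\<close>, and the counit law of \<open>H\<close> removes \<open>\<epsilon>(h\<^sub>(\<^sub>2\<^sub>))\<close>.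
\<close>

lemma action_base_proj:
  assumes h: "h \<in> carrier H" and b: "b \<in> carrier B"
  shows "base_proj ((\<one>\<^bsub>B\<^esub> \<ltimes> h) \<otimes>\<^bsub>A\<^esub> (b \<ltimes> \<one>\<^bsub>H\<^esub>)) = action B h b"
proof -
  note rules = assms biproduct_multilinear
  have "base_proj ((\<one>\<^bsub>B\<^esub> \<ltimes> h) \<otimes>\<^bsub>A\<^esub> (b \<ltimes> \<one>\<^bsub>H\<^esub>)) =
    sweedler K B (comult H h)
      (\<lambda>h1 h2. base_proj ((\<one>\<^bsub>B\<^esub> \<otimes>\<^bsub>B\<^esub> action B h1 b) \<ltimes> (h2 \<otimes>\<^bsub>H\<^esub> \<one>\<^bsub>H\<^esub>)))"
    unfolding biproduct_mult_pure[OF B.one_closed h b H.one_closed]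
    by (rule sweedler_linear, (assumption | rule rules base_proj_linear)+)
  also have "\<dots> = sweedler K B (comult H h) (\<lambda>h1 h2. action B (counit H h2 \<odot>\<^bsub>H\<^esub> h1) b)"
    by (rule sweedler_cong, (assumption | rule rules)+)
       (simp add: base_proj_pure bilinear_map_closed[OF action_bilinear]
         linear_mapD(3)[OF linear_map_action_left[OF linear_map_id b]] b H.counit_closed)
  also have "\<dots> = action B (sweedler K H (comult H h) (\<lambda>h1 h2. counit H h2 \<odot>\<^bsub>H\<^esub> h1)) b"
    by (rule sweedler_linear[symmetric], (assumption | rule rules)+)
  finally show ?thesis by (simp add: H.counit_right h)
qed

lemma base_mult_pure:
  assumes "b \<in> carrier B" "b' \<in> carrier B" "h \<in> carrier H"
  shows "(b \<ltimes> \<one>\<^bsub>H\<^esub>) \<otimes>\<^bsub>A\<^esub> (b' \<ltimes> h) = (b \<otimes>\<^bsub>B\<^esub> b') \<ltimes> h"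
  unfolding biproduct_mult_pure[OF assms(1) H.one_closed assms(2,3)] H.comult_one
  by (rule trans, rule sweedler_tens, (assumption | rule assms multilinear)+)
     (simp add: assms action_one)

text \<open>
  On \<open>a = b \<ltimes> h\<close> the sum \<open>P(a\<^sub>(\<^sub>1\<^sub>)) \<ltimes> \<pi>(a\<^sub>(\<^sub>2\<^sub>))\<close> is
  \<open>\<epsilon>(b\<^sub>(\<^sub>2\<^sub>)\<^sub>(\<^sub>-\<^sub>1\<^sub>)) \<epsilon>(h\<^sub>(\<^sub>1\<^sub>)) \<epsilon>(b\<^sub>(\<^sub>2\<^sub>)\<^sub>(\<^sub>0\<^sub>)) b\<^sub>(\<^sub>1\<^sub>) \<ltimes> h\<^sub>(\<^sub>2\<^sub>)\<close>, and the counit laws of \<open>H\<close>, of the coaction and of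
  \<open>B\<close>, applied from the innermost sum outwards, reduce it to \<open>b \<ltimes> h\<close>.
\<close>

lemma sweedler_base_proj_proj:
  assumes a: "a \<in> carrier T"
  shows "sweedler K T (comult A a) (\<lambda>a1 a2. base_proj a1 \<ltimes> biproduct_proj K H B a2) = a"
proof (rule tensor_ext[OF B.module_axioms H.module_axioms module_T _ linear_map_id _ a])
  interpret T: module K T by (rule module_T)
  note rules = biproduct_multilinear
  fix b h assume b: "b \<in> carrier B" and h: "h \<in> carrier H"
  have 1: "sweedler K T (comult H h) (\<lambda>h1 h2.
      base_proj (b1 \<ltimes> (x \<otimes>\<^bsub>H\<^esub> h1)) \<ltimes> biproduct_proj K H B (b20 \<ltimes> h2)) =
    (counit B (counit H x \<odot>\<^bsub>B\<^esub> b20) \<odot>\<^bsub>B\<^esub> b1) \<ltimes> h" (is "?l = _ ")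
    if c: "b1 \<in> carrier B" "x \<in> carrier H" "b20 \<in> carrier B" for b1 x b20
  proof -
    let ?c = "counit B (counit H x \<odot>\<^bsub>B\<^esub> b20)"
    \<comment> \<open>\<open>\<epsilon>(\<epsilon>(x)b)\<close> is kept unexpanded: it is the form to which the counit law of the coaction applies.\<close>
    have c': "?c = counit H x \<otimes>\<^bsub>K\<^esub> counit B b20"
      using c by (simp add: linear_mapD(3)[OF B.counit_linear] H.counit_closed)
        (simp add: field_as_module_def)
    have "?l = sweedler K T (comult H h) (\<lambda>h1 h2. (?c \<odot>\<^bsub>B\<^esub> b1) \<ltimes> (counit H h1 \<odot>\<^bsub>H\<^esub> h2))"
      by (rule sweedler_cong, (assumption | rule h c rules)+)
         (simp add: c c' base_proj_pure biproduct_proj_pure H.counit_mult H.counit_closed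
           B.counit_closed tens_smult_left tens_smult_right H.module_axioms B.module_axioms
           tens_carrier T.smult_assoc1[symmetric] H.R.m_ac)
    also have "\<dots> = (?c \<odot>\<^bsub>B\<^esub> b1) \<ltimes> sweedler K H (comult H h) (\<lambda>h1 h2. counit H h1 \<odot>\<^bsub>H\<^esub> h2)"
      by (rule sweedler_linear[symmetric], (assumption | rule h c rules)+)
    finally show ?thesis by (simp add: H.counit_left h)
  qed
  have 2: "sweedler K T (coaction B b2) (\<lambda>x b20. sweedler K T (comult H h) (\<lambda>h1 h2.
      base_proj (b1 \<ltimes> (x \<otimes>\<^bsub>H\<^esub> h1)) \<ltimes> biproduct_proj K H B (b20 \<ltimes> h2))) =
    (counit B b2 \<odot>\<^bsub>B\<^esub> b1) \<ltimes> h" (is "?l = _")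
    if c: "b1 \<in> carrier B" "b2 \<in> carrier B" for b1 b2
  proof -
    have "?l = sweedler K T (coaction B b2) (\<lambda>x b20. (counit B (counit H x \<odot>\<^bsub>B\<^esub> b20) \<odot>\<^bsub>B\<^esub> b1) \<ltimes> h)"
      by (rule sweedler_cong, (assumption | rule h c 1 rules)+)
    also have "\<dots> = (counit B (sweedler K B (coaction B b2) (\<lambda>x b20. counit H x \<odot>\<^bsub>B\<^esub> b20)) \<odot>\<^bsub>B\<^esub> b1) \<ltimes> h"
      by (rule sweedler_linear[symmetric], (assumption | rule h c rules)+)
    finally show ?thesis by (simp add: coaction_counit c)
  qed
  have "sweedler K T (comult A (b \<ltimes> h)) (\<lambda>a1 a2. base_proj a1 \<ltimes> biproduct_proj K H B a2) =
    sweedler K T (comult B b) (\<lambda>b1 b2. sweedler K T (coaction B b2) (\<lambda>x b20.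
      sweedler K T (comult H h) (\<lambda>h1 h2.
        base_proj (b1 \<ltimes> (x \<otimes>\<^bsub>H\<^esub> h1)) \<ltimes> biproduct_proj K H B (b20 \<ltimes> h2))))"
    by (rule sweedler_biproduct_comult, (assumption | rule b h rules)+)
  also have "\<dots> = sweedler K T (comult B b) (\<lambda>b1 b2. (counit B b2 \<odot>\<^bsub>B\<^esub> b1) \<ltimes> h)"
    by (rule sweedler_cong, (assumption | rule b h 2 rules)+)
  also have "\<dots> = sweedler K B (comult B b) (\<lambda>b1 b2. counit B b2 \<odot>\<^bsub>B\<^esub> b1) \<ltimes> h"
    by (rule sweedler_linear[symmetric], (assumption | rule b h rules)+)
  finally show "sweedler K T (comult A (b \<ltimes> h)) (\<lambda>a1 a2. base_proj a1 \<ltimes> biproduct_proj K H B a2) = b \<ltimes> h"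
    by (simp add: B.counit_right b)
qed (assumption | rule biproduct_multilinear)+


section \<open>Endomorphisms of \<open>B\<close> and of the biproduct\<close>

sublocale B_structure: bialgebra_structure K B
  by unfold_locales (auto intro: B.comult_closed)

lemma biproduct_structure: "bialgebra_structure K A"
proof -
  interpret A: module K A by (rule biproduct_module)
  show ?thesis
  proof
    show "\<one>\<^bsub>A\<^esub> \<in> carrier A"
      unfolding biproduct_simps by (assumption | rule multilinear)+
    fix x y assume x: "x \<in> carrier A" and y: "y \<in> carrier A"
    show "x \<otimes>\<^bsub>A\<^esub> y \<in> carrier A"
      using linear_mapD(1)[OF linear_map_biproduct_mult_left[OF linear_map_id _ module_T]] x y
      by (simp add: biproduct_simps)
    show "comult A x \<in> carrier (tensor_space K A A)"
      using linear_mapD(1)[OF biproduct_comult_linear] x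
      by (simp add: biproduct_simps tensor_space_biproduct)
  qed
qed


sublocale A_structure: bialgebra_structure K A
  by (rule biproduct_structure)

lemma End_YD_iff:
  "f \<in> carrier (End_YD K H B) \<longleftrightarrow> f \<in> extensional (carrier B) \<and> hopf_map K B B f \<and>
    (\<forall>h\<in>carrier H. \<forall>b\<in>carrier B. f (action B h b) = action B h (f b)) \<and>
    (\<forall>b\<in>carrier B. coaction B (f b) =
      sweedler K (tensor_space K H B) (coaction B b) (\<lambda>x b0. tens K H B x (f b0)))"
  by (auto simp: End_YD_def hopf_map_def)

lemma End_YD_eq:
  "End_YD K H B = \<lparr>carrier = carrier (End_YD K H B),
    mult = compose (carrier B), one = (\<lambda>b\<in>carrier B. b)\<rparr>"
  by (simp add: End_YD_def)

text \<open>
  Sweedler notation for colinearity, \<open>\<rho>(f(b)) = b\<^sub>(\<^sub>-\<^sub>1\<^sub>) \<otimes> f(b\<^sub>(\<^sub>0\<^sub>))\<close>, in the style of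
  \<open>sweedler_coalgebra_map\<close>.
\<close>

lemma sweedler_coaction_map:
  assumes f: "linear_map K B B f"
    and co: "coaction B (f b) =
      sweedler K (tensor_space K H B) (coaction B b) (\<lambda>x b0. tens K H B x (f b0))"
    and b: "b \<in> carrier B" and U: "module K U" and \<beta>: "bilinear_map K H B U \<beta>"
  shows "sweedler K U (coaction B (f b)) \<beta> = sweedler K U (coaction B b) (\<lambda>x b0. \<beta> x (f b0))"
proof -
  note rules = b U \<beta> multilinear linear_map_compose[OF f] linear_mapD(1)[OF f]
    bilinear_map_left[OF \<beta>] bilinear_map_right[OF \<beta>]
  have "sweedler K U (coaction B (f b)) \<beta> =
      sweedler K U (coaction B b) (\<lambda>x b0. sweedler K U (tens K H B x (f b0)) \<beta>)"
    unfolding co by (rule sweedler_sweedler, (assumption | rule rules)+)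
  also have "\<dots> = sweedler K U (coaction B b) (\<lambda>x b0. \<beta> x (f b0))"
    by (rule sweedler_cong[symmetric], (assumption | rule rules sweedler_tens[symmetric])+)
  finally show ?thesis .
qed

lemma monoid_End_YD: "monoid (End_YD K H B)"
proof -
  have "monoid \<lparr>carrier = carrier (End_YD K H B),
    mult = compose (carrier B), one = (\<lambda>b\<in>carrier B. b)\<rparr>"
  proof (rule monoid_of_maps)
    show "f \<in> extensional (carrier B) \<and> f \<in> carrier B \<rightarrow> carrier B" if "f \<in> carrier (End_YD K H B)" for f
      using that B_structure.hopf_mapD(3) unfolding End_YD_iff by blast
    have "coaction B b = sweedler K (tensor_space K H B) (coaction B b)
        (\<lambda>x b0. tens K H B x ((\<lambda>b\<in>carrier B. b) b0))" if b: "b \<in> carrier B" for b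
    proof -
      have "coaction B b = sweedler K (tensor_space K H B) (coaction B b) (tens K H B)"
        by (rule sweedler_self[symmetric], (assumption | rule b multilinear)+)
      also have "\<dots> = sweedler K (tensor_space K H B) (coaction B b)
        (\<lambda>x b0. tens K H B x ((\<lambda>b\<in>carrier B. b) b0))"
        by (rule sweedler_cong, (assumption | rule b multilinear)+) simp
      finally show ?thesis .
    qed
    then show "(\<lambda>b\<in>carrier B. b) \<in> carrier (End_YD K H B)"
      unfolding End_YD_iff using bilinear_map_closed[OF action_bilinear]
      by (auto intro: B_structure.hopf_map_cong[OF B_structure.hopf_map_id])
    fix f g assume "f \<in> carrier (End_YD K H B)" "g \<in> carrier (End_YD K H B)"
    note f = this(1)[unfolded End_YD_iff] and g = this(2)[unfolded End_YD_iff]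
    have lin: "linear_map K B B f" "linear_map K B B g" using f g B_structure.hopf_mapD(1) by auto
    have gc: "g b \<in> carrier B" if "b \<in> carrier B" for b by (rule linear_mapD(1)[OF lin(2) that])
    have "coaction B (f (g b)) = sweedler K (tensor_space K H B) (coaction B b)
        (\<lambda>x b0. tens K H B x (compose (carrier B) f g b0))" if b: "b \<in> carrier B" for b
    proof -
      note rules = b gc multilinear linear_map_compose[OF lin(1)] linear_map_compose[OF lin(2)]
        linear_mapD(1)[OF lin(1)]
      have "coaction B (f (g b)) =
          sweedler K (tensor_space K H B) (coaction B (g b)) (\<lambda>x b0. tens K H B x (f b0))"
        using f gc[OF b] by blast
      also have "\<dots> = sweedler K (tensor_space K H B) (coaction B b) (\<lambda>x b0. tens K H B x (f (g b0)))"
        by (rule sweedler_coaction_map[OF lin(2)], use g b in blast, (assumption | rule rules)+)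
      also have "\<dots> = sweedler K (tensor_space K H B) (coaction B b)
          (\<lambda>x b0. tens K H B x (compose (carrier B) f g b0))"
        by (rule sweedler_cong, (assumption | rule rules)+) (simp add: compose_def)
      finally show ?thesis .
    qed
    moreover have "hopf_map K B B f" "hopf_map K B B g" using f g by blast+
    then have "hopf_map K B B (compose (carrier B) f g)"
      by (rule B_structure.hopf_map_cong[OF B_structure.hopf_map_comp]) (simp add: compose_def)
    ultimately show "compose (carrier B) f g \<in> carrier (End_YD K H B)"
      unfolding End_YD_iff using f g gc bilinear_map_closed[OF action_bilinear]
      by (auto simp: compose_def)
  qed
  then show ?thesis by (simp flip: End_YD_eq)
qed

lemma biproduct_map_eq:
  "t \<in> carrier T \<Longrightarrow> biproduct_map K H B f t = sweedler K T t (\<lambda>b h. f b \<ltimes> h)"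
  by (simp add: biproduct_map_def biproduct_simps sweedler_biproduct)

lemma biproduct_map_linear:
  assumes f: "linear_map K B B f"
  shows "linear_map K T T (biproduct_map K H B f)"
proof (rule linear_map_cong[OF module_T _ biproduct_map_eq[symmetric]])
  show "linear_map K T T (\<lambda>t. sweedler K T t (\<lambda>b h. f b \<ltimes> h))"
    by (assumption | rule multilinear linear_map_compose[OF f] linear_mapD(1)[OF f])+
qed

lemma pure_closed: "b \<in> carrier B \<Longrightarrow> h \<in> carrier H \<Longrightarrow> b \<ltimes> h \<in> carrier T"
  by (assumption | rule multilinear)+

lemma biproduct_map_pure:
  assumes f: "linear_map K B B f" and b: "b \<in> carrier B" and h: "h \<in> carrier H"
  shows "biproduct_map K H B f (b \<ltimes> h) = f b \<ltimes> h"
  unfolding biproduct_map_eq[OF pure_closed[OF b h]]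
  by (rule sweedler_tens, (assumption | rule b h multilinear linear_map_compose[OF f] linear_mapD(1)[OF f])+)

lemma biproduct_mult_closed: "s \<in> carrier T \<Longrightarrow> t \<in> carrier T \<Longrightarrow> s \<otimes>\<^bsub>A\<^esub> t \<in> carrier T"
  using A_structure.mult_closed by (simp add: biproduct_simps)

text \<open>
  All conditions are checked on pure tensors. Multiplicativity comes from \<open>f\<close> being an algebra map
  and \<open>H\<close>-linear, compatibility with the coproduct from \<open>f\<close> being a coalgebra map and \<open>H\<close>-colinear.
\<close>

lemma biproduct_map_End_Hopf:
  assumes f: "f \<in> carrier (End_YD K H B)"
  shows "biproduct_map K H B f \<in> carrier (End_Hopf K H A (biproduct_proj K H B) (biproduct_incl K H B))"
proof -
  note f' = f[unfolded End_YD_iff]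
  note hopf = B_structure.hopf_mapD[OF f'[THEN conjunct2, THEN conjunct1]]
  note lin = hopf(1)
  define F where "F = biproduct_map K H B f"
  have F: "linear_map K T T F" unfolding F_def by (rule biproduct_map_linear[OF lin])
  have pure: "F (b \<ltimes> h) = f b \<ltimes> h" if "b \<in> carrier B" "h \<in> carrier H" for b h
    unfolding F_def by (rule biproduct_map_pure[OF lin that])
  have fc: "f b \<in> carrier B" if "b \<in> carrier B" for b by (rule linear_mapD(1)[OF lin that])
  have fact: "action B h (f b) = f (action B h b)" if "h \<in> carrier H" "b \<in> carrier B" for h b
    using f' that by simp
  note rules = biproduct_multilinear module_T F linear_map_compose[OF F] linear_mapD(1)[OF F]
    linear_map_compose[OF lin] fc
  have mult: "F (s \<otimes>\<^bsub>A\<^esub> t) = F s \<otimes>\<^bsub>A\<^esub> F t" if s: "s \<in> carrier T" and t: "t \<in> carrier T" for s t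
  proof (rule tensor_ext[OF B.module_axioms H.module_axioms module_T _ _ _ s])
    fix b h assume bh: "b \<in> carrier B" "h \<in> carrier H"
    show "F ((b \<ltimes> h) \<otimes>\<^bsub>A\<^esub> t) = F (b \<ltimes> h) \<otimes>\<^bsub>A\<^esub> F t"
    proof (rule tensor_ext[OF B.module_axioms H.module_axioms module_T _ _ _ t])
      fix b' h' assume bh': "b' \<in> carrier B" "h' \<in> carrier H"
      have "F ((b \<ltimes> h) \<otimes>\<^bsub>A\<^esub> (b' \<ltimes> h')) = sweedler K T (comult H h)
          (\<lambda>h1 h2. F ((b \<otimes>\<^bsub>B\<^esub> action B h1 b') \<ltimes> (h2 \<otimes>\<^bsub>H\<^esub> h')))"
        unfolding biproduct_mult_pure[OF bh bh']
        by (rule sweedler_linear, (assumption | rule bh bh' rules)+)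
      also have "\<dots> = sweedler K T (comult H h)
          (\<lambda>h1 h2. (f b \<otimes>\<^bsub>B\<^esub> action B h1 (f b')) \<ltimes> (h2 \<otimes>\<^bsub>H\<^esub> h'))"
        by (rule sweedler_cong, (assumption | rule bh bh' rules)+)
           (simp add: pure bh bh' bilinear_map_closed[OF action_bilinear] hopf(5) fact)
      also have "\<dots> = F (b \<ltimes> h) \<otimes>\<^bsub>A\<^esub> F (b' \<ltimes> h')"
        by (simp add: pure biproduct_mult_pure bh bh' fc)
      finally show "F ((b \<ltimes> h) \<otimes>\<^bsub>A\<^esub> (b' \<ltimes> h')) = F (b \<ltimes> h) \<otimes>\<^bsub>A\<^esub> F (b' \<ltimes> h')" .
    qed (assumption | rule bh rules)+
  qed (assumption | rule t rules)+
  have comult: "comult A (F t) =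
      sweedler K (tensor_space K T T) (comult A t) (\<lambda>a1 a2. tens K T T (F a1) (F a2))"
    if t: "t \<in> carrier T" for t
  proof (rule tensor_ext[OF B.module_axioms H.module_axioms tensor_space_module[OF module_T module_T] _ _ _ t])
    fix b h assume bh: "b \<in> carrier B" "h \<in> carrier H"
    let ?TT = "tensor_space K T T"
    have "comult A (F (b \<ltimes> h)) =
      sweedler K ?TT (comult B (f b)) (\<lambda>b1 b2. sweedler K ?TT (coaction B b2) (\<lambda>x b20.
        sweedler K ?TT (comult H h) (\<lambda>h1 h2. tens K T T (b1 \<ltimes> (x \<otimes>\<^bsub>H\<^esub> h1)) (b20 \<ltimes> h2))))"
      by (simp add: pure bh biproduct_comult_pure fc)
    also have "\<dots> =
      sweedler K ?TT (comult B b) (\<lambda>b1 b2. sweedler K ?TT (coaction B (f b2)) (\<lambda>x b20.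
        sweedler K ?TT (comult H h) (\<lambda>h1 h2. tens K T T (f b1 \<ltimes> (x \<otimes>\<^bsub>H\<^esub> h1)) (b20 \<ltimes> h2))))"
      by (rule sweedler_coalgebra_map[OF hopf(2)], (assumption | rule bh rules)+)
    also have "\<dots> =
      sweedler K ?TT (comult B b) (\<lambda>b1 b2. sweedler K ?TT (coaction B b2) (\<lambda>x b20.
        sweedler K ?TT (comult H h) (\<lambda>h1 h2. tens K T T (f b1 \<ltimes> (x \<otimes>\<^bsub>H\<^esub> h1)) (f b20 \<ltimes> h2))))"
      by (rule sweedler_cong, (assumption | rule bh rules)+,
          rule sweedler_coaction_map[OF lin], use f' in blast, (assumption | rule bh rules)+)
    also have "\<dots> =
      sweedler K ?TT (comult B b) (\<lambda>b1 b2. sweedler K ?TT (coaction B b2) (\<lambda>x b20.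
        sweedler K ?TT (comult H h) (\<lambda>h1 h2.
          tens K T T (F (b1 \<ltimes> (x \<otimes>\<^bsub>H\<^esub> h1))) (F (b20 \<ltimes> h2)))))"
      by (rule sweedler_cong, (assumption | rule bh rules)+)+ (simp add: pure)
    also have "\<dots> = sweedler K ?TT (comult A (b \<ltimes> h)) (\<lambda>a1 a2. tens K T T (F a1) (F a2))"
      by (rule sweedler_biproduct_comult[symmetric], (assumption | rule bh rules)+)
    finally show "comult A (F (b \<ltimes> h)) =
      sweedler K ?TT (comult A (b \<ltimes> h)) (\<lambda>a1 a2. tens K T T (F a1) (F a2))" .
  qed (assumption | rule t rules)+
  have counit: "counit A (F t) = counit A t" if t: "t \<in> carrier T" for t
    by (rule tensor_ext[OF B.module_axioms H.module_axioms field_as_module_module _ _ _ t],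
        (assumption | rule rules biproduct_counit_linear)+)
       (simp add: pure biproduct_counit_pure fc hopf(6))
  have proj: "biproduct_proj K H B (F t) = biproduct_proj K H B t" if t: "t \<in> carrier T" for t
    by (rule tensor_ext[OF B.module_axioms H.module_axioms H.module_axioms _ _ _ t],
        (assumption | rule rules biproduct_proj_linear)+)
       (simp add: pure biproduct_proj_pure fc hopf(6))
  have incl: "F (\<one>\<^bsub>B\<^esub> \<ltimes> h) = \<one>\<^bsub>B\<^esub> \<ltimes> h" if "h \<in> carrier H" for h
    by (simp add: pure that hopf(4))
  have "hopf_map K A A F"
    by (rule A_structure.hopf_mapI)
       (simp_all add: linear_map_biproduct F biproduct_simps incl mult counit comult
         tensor_space_biproduct tens_biproduct)
  then show ?thesis
    unfolding F_def[symmetric] A_structure.End_Hopf_iff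
    by (simp add: biproduct_simps proj incl biproduct_incl_def) (simp add: F_def biproduct_map_def biproduct_simps)
qed

lemma bilinear_map_biproduct: "bilinear_map K A A U \<beta> \<longleftrightarrow> bilinear_map K T T U \<beta>"
  by (simp add: bilinear_map_def linear_map_def biproduct_simps)

lemma sweedler_comult_End_Hopf:
  assumes F: "hopf_map K A A F" and a: "a \<in> carrier T" and U: "module K U" and \<beta>: "bilinear_map K T T U \<beta>"
  shows "sweedler K U (comult A (F a)) \<beta> = sweedler K U (comult A a) (\<lambda>a1 a2. \<beta> (F a1) (F a2))"
  using a \<beta> A_structure.comult_closed
  by (intro sweedler_coalgebra_map[OF A_structure.hopf_mapD(2)[OF F] biproduct_module biproduct_module U])
     (auto simp: bilinear_map_biproduct biproduct_simps)

text \<open>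
  The elements \<open>b \<ltimes> 1\<close> are the coinvariants of \<open>A\<close> along \<open>\<pi>\<close>, and a coalgebra map over \<open>H\<close> preserves
  coinvariants. In formulas: expand \<open>a = F(b \<ltimes> 1)\<close> as \<open>P(a\<^sub>(\<^sub>1\<^sub>)) \<ltimes> \<pi>(a\<^sub>(\<^sub>2\<^sub>))\<close>, move \<open>F\<close> to the two factors of
  \<open>\<Delta>(b \<ltimes> 1)\<close>, drop it in front of \<open>\<pi>\<close>, and observe that \<open>\<pi>(b\<^sub>(\<^sub>2\<^sub>)\<^sub>(\<^sub>0\<^sub>) \<ltimes> 1)\<close> is a multiple of \<open>1\<close>.
\<close>

lemma End_Hopf_preserves_base:
  assumes F: "hopf_map K A A F"
    and proj: "\<And>a. a \<in> carrier T \<Longrightarrow> biproduct_proj K H B (F a) = biproduct_proj K H B a"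
    and b: "b \<in> carrier B"
  shows "F (b \<ltimes> \<one>\<^bsub>H\<^esub>) = base_proj (F (b \<ltimes> \<one>\<^bsub>H\<^esub>)) \<ltimes> \<one>\<^bsub>H\<^esub>"
proof -
  have lin: "linear_map K T T F" using A_structure.hopf_mapD(1)[OF F] by (simp add: linear_map_biproduct)
  note rules = biproduct_multilinear module_T lin linear_map_compose[OF lin] linear_mapD(1)[OF lin]
  have inner: "sweedler K T (coaction B b2)
      (\<lambda>x b20. base_proj (F (b1 \<ltimes> x)) \<ltimes> biproduct_proj K H B (b20 \<ltimes> \<one>\<^bsub>H\<^esub>)) =
      base_proj (F ((counit B b2 \<odot>\<^bsub>B\<^esub> b1) \<ltimes> \<one>\<^bsub>H\<^esub>)) \<ltimes> \<one>\<^bsub>H\<^esub>" (is "?l = _")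
    if c: "b1 \<in> carrier B" "b2 \<in> carrier B" for b1 b2
  proof -
    have "?l = sweedler K T (coaction B b2) (\<lambda>x b20. base_proj (F (b1 \<ltimes> (counit B b20 \<odot>\<^bsub>H\<^esub> x))) \<ltimes> \<one>\<^bsub>H\<^esub>)"
      by (rule sweedler_cong, (assumption | rule c rules)+)
         (simp add: c biproduct_proj_pure B.counit_closed tens_smult_left tens_smult_right
           B.module_axioms H.module_axioms linear_mapD[OF lin] linear_mapD[OF base_proj_linear] pure_closed)
    also have "\<dots> = base_proj (F (b1 \<ltimes> sweedler K H (coaction B b2) (\<lambda>x b20. counit B b20 \<odot>\<^bsub>H\<^esub> x))) \<ltimes> \<one>\<^bsub>H\<^esub>"
      by (rule sweedler_linear[symmetric], (assumption | rule c rules)+)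
    finally show ?thesis
      by (simp add: c coaction_counit_coalgebra B.counit_closed tens_smult_left tens_smult_right
          B.module_axioms H.module_axioms)
  qed
  have Fb: "F (b \<ltimes> \<one>\<^bsub>H\<^esub>) \<in> carrier T" by (rule linear_mapD(1)[OF lin pure_closed[OF b H.one_closed]])
  \<comment> \<open>With \<open>inner\<close> the sum becomes \<open>P(F(\<epsilon>(b\<^sub>(\<^sub>2\<^sub>))b\<^sub>(\<^sub>1\<^sub>) \<ltimes> 1)) \<ltimes> 1\<close>, to which the counit law of \<open>B\<close> applies.\<close>
  have "F (b \<ltimes> \<one>\<^bsub>H\<^esub>) = sweedler K T (comult A (F (b \<ltimes> \<one>\<^bsub>H\<^esub>)))
      (\<lambda>a1 a2. base_proj a1 \<ltimes> biproduct_proj K H B a2)"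
    by (rule sweedler_base_proj_proj[OF Fb, symmetric])
  also have "\<dots> = sweedler K T (comult A (b \<ltimes> \<one>\<^bsub>H\<^esub>))
      (\<lambda>a1 a2. base_proj (F a1) \<ltimes> biproduct_proj K H B (F a2))"
    by (rule sweedler_comult_End_Hopf[OF F], (assumption | rule b rules)+)
  also have "\<dots> = sweedler K T (comult A (b \<ltimes> \<one>\<^bsub>H\<^esub>))
      (\<lambda>a1 a2. base_proj (F a1) \<ltimes> biproduct_proj K H B a2)"
    by (rule sweedler_cong, (assumption | rule b rules)+) (simp add: proj)
  also have "\<dots> = sweedler K T (comult B b) (\<lambda>b1 b2. sweedler K T (coaction B b2)
      (\<lambda>x b20. base_proj (F (b1 \<ltimes> x)) \<ltimes> biproduct_proj K H B (b20 \<ltimes> \<one>\<^bsub>H\<^esub>)))"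
    by (rule sweedler_biproduct_comult_base, (assumption | rule b rules)+)
  also have "\<dots> = sweedler K T (comult B b)
      (\<lambda>b1 b2. base_proj (F ((counit B b2 \<odot>\<^bsub>B\<^esub> b1) \<ltimes> \<one>\<^bsub>H\<^esub>)) \<ltimes> \<one>\<^bsub>H\<^esub>)"
    by (rule sweedler_cong, (assumption | rule b inner rules)+)
  also have "\<dots> = base_proj (F (sweedler K B (comult B b) (\<lambda>b1 b2. counit B b2 \<odot>\<^bsub>B\<^esub> b1) \<ltimes> \<one>\<^bsub>H\<^esub>)) \<ltimes> \<one>\<^bsub>H\<^esub>"
    by (rule sweedler_linear[symmetric], (assumption | rule b rules)+)
  finally show ?thesis by (simp add: B.counit_right b)
qed

text \<open>
  The preimage of \<open>F\<close> is \<open>f(b) = P(F(b \<ltimes> 1))\<close>. Once \<open>F(b \<ltimes> h) = f(b) \<ltimes> h\<close> is known, the formulas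
  expressing the structure of \<open>B\<close> through \<open>P\<close> and \<open>\<pi>\<close> transfer each property of \<open>F\<close> to \<open>f\<close>.
\<close>

lemma End_Hopf_induced:
  assumes "F \<in> carrier (End_Hopf K H A (biproduct_proj K H B) (biproduct_incl K H B))"
  shows "\<exists>f\<in>carrier (End_YD K H B). biproduct_map K H B f = F"
proof -
  note F = assms[unfolded A_structure.End_Hopf_iff]
  then have hopf: "hopf_map K A A F" by blast
  note D = A_structure.hopf_mapD[OF hopf]
  have lin: "linear_map K T T F" using D(1) by (simp add: linear_map_biproduct)
  have proj: "biproduct_proj K H B (F a) = biproduct_proj K H B a" if "a \<in> carrier T" for a
    using F that by (simp add: biproduct_simps)
  have incl: "F (\<one>\<^bsub>B\<^esub> \<ltimes> h) = \<one>\<^bsub>B\<^esub> \<ltimes> h" if "h \<in> carrier H" for h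
    using F that by (simp add: biproduct_incl_def)
  have mult: "F (s \<otimes>\<^bsub>A\<^esub> t) = F s \<otimes>\<^bsub>A\<^esub> F t" if "s \<in> carrier T" "t \<in> carrier T" for s t
    using D(5) that by (simp add: biproduct_simps)
  have counit: "counit A (F t) = counit A t" if "t \<in> carrier T" for t
    using D(6) that by (simp add: biproduct_simps)
  define f where "f = (\<lambda>b\<in>carrier B. base_proj (F (b \<ltimes> \<one>\<^bsub>H\<^esub>)))"
  have Fbase: "F (b \<ltimes> \<one>\<^bsub>H\<^esub>) = f b \<ltimes> \<one>\<^bsub>H\<^esub>" if "b \<in> carrier B" for b
    using End_Hopf_preserves_base[OF hopf proj that] that by (simp add: f_def)
  have flin: "linear_map K B B f"
  proof (rule linear_map_cong[OF B.module_axioms, where f = "\<lambda>b. base_proj (F (b \<ltimes> \<one>\<^bsub>H\<^esub>))"])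
    show "linear_map K B B (\<lambda>b. base_proj (F (b \<ltimes> \<one>\<^bsub>H\<^esub>)))"
      by (assumption | rule biproduct_multilinear linear_map_compose[OF lin])+
  qed (simp add: f_def)
  have fc: "f b \<in> carrier B" if "b \<in> carrier B" for b by (rule linear_mapD(1)[OF flin that])
  note rules = biproduct_multilinear module_T lin linear_map_compose[OF lin] linear_mapD(1)[OF lin]
    linear_map_compose[OF flin] fc
  \<comment> \<open>\<open>b \<ltimes> h = (b \<ltimes> 1)(1 \<ltimes> h)\<close>, and \<open>F\<close> fixes the second factor.\<close>
  have Fpure: "F (b \<ltimes> h) = f b \<ltimes> h" if "b \<in> carrier B" "h \<in> carrier H" for b h
    using mult[OF pure_closed[OF that(1) H.one_closed] pure_closed[OF B.one_closed that(2)]]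
    by (simp add: base_mult_pure that fc Fbase incl)
  have base_F: "base_proj (F t) = f (base_proj t)" if t: "t \<in> carrier T" for t
    by (rule tensor_ext[OF B.module_axioms H.module_axioms B.module_axioms _ _ _ t],
        (assumption | rule rules base_proj_linear)+)
       (simp add: Fpure base_proj_pure fc linear_mapD(3)[OF flin] H.counit_closed)
  have fone: "f \<one>\<^bsub>B\<^esub> = \<one>\<^bsub>B\<^esub>"
    by (simp add: f_def incl base_proj_base)
  have fmult: "f (b \<otimes>\<^bsub>B\<^esub> b') = f b \<otimes>\<^bsub>B\<^esub> f b'" if "b \<in> carrier B" "b' \<in> carrier B" for b b'
    using mult[OF pure_closed[OF that(1) H.one_closed] pure_closed[OF that(2) H.one_closed]] that
    by (simp add: base_mult_pure fc Fbase)
       (metis B.m_closed base_proj_base fc)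
  have faction: "f (action B h b) = action B h (f b)" if h: "h \<in> carrier H" and b: "b \<in> carrier B" for h b
  proof -
    have c: "\<one>\<^bsub>B\<^esub> \<ltimes> h \<in> carrier T" "b \<ltimes> \<one>\<^bsub>H\<^esub> \<in> carrier T" by (simp_all add: pure_closed h b)
    have "f (action B h b) = base_proj (F ((\<one>\<^bsub>B\<^esub> \<ltimes> h) \<otimes>\<^bsub>A\<^esub> (b \<ltimes> \<one>\<^bsub>H\<^esub>)))"
      by (simp add: base_F[OF biproduct_mult_closed[OF c]] action_base_proj h b)
    also have "\<dots> = action B h (f b)"
      by (simp add: mult[OF c] incl Fbase h b action_base_proj fc)
    finally show ?thesis .
  qed
  have fcounit: "counit B (f b) = counit B b" if b: "b \<in> carrier B" for b
    using counit_base_proj[OF pure_closed[OF fc[OF b] H.one_closed]]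
      counit_base_proj[OF pure_closed[OF b H.one_closed]] counit[OF pure_closed[OF b H.one_closed]]
    by (simp add: Fbase base_proj_base b fc)
  have fcomult: "comult B (f b) =
      sweedler K (tensor_space K B B) (comult B b) (\<lambda>b1 b2. tens K B B (f b1) (f b2))"
    if b: "b \<in> carrier B" for b
  proof -
    let ?BB = "tensor_space K B B"
    have "comult B (f b) = sweedler K ?BB (comult A (F (b \<ltimes> \<one>\<^bsub>H\<^esub>)))
        (\<lambda>a1 a2. tens K B B (base_proj a1) (base_proj a2))"
      by (simp add: comult_base_proj fc b Fbase)
    also have "\<dots> = sweedler K ?BB (comult A (b \<ltimes> \<one>\<^bsub>H\<^esub>))
        (\<lambda>a1 a2. tens K B B (base_proj (F a1)) (base_proj (F a2)))"
      by (rule sweedler_comult_End_Hopf[OF hopf], (assumption | rule b rules)+)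
    also have "\<dots> = sweedler K ?BB (comult A (b \<ltimes> \<one>\<^bsub>H\<^esub>))
        (\<lambda>a1 a2. sweedler K ?BB (tens K B B (base_proj a1) (base_proj a2)) (\<lambda>b1 b2. tens K B B (f b1) (f b2)))"
      by (rule sweedler_cong, (assumption | rule b rules)+, subst sweedler_tens, (assumption | rule rules)+)
         (simp add: base_F)
    also have "\<dots> = sweedler K ?BB (sweedler K ?BB (comult A (b \<ltimes> \<one>\<^bsub>H\<^esub>))
        (\<lambda>a1 a2. tens K B B (base_proj a1) (base_proj a2))) (\<lambda>b1 b2. tens K B B (f b1) (f b2))"
      by (rule sweedler_sweedler[symmetric], (assumption | rule b rules)+)
    finally show ?thesis by (simp add: comult_base_proj b)
  qed
  have fcoaction: "coaction B (f b) =
      sweedler K (tensor_space K H B) (coaction B b) (\<lambda>x b0. tens K H B x (f b0))"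
    if b: "b \<in> carrier B" for b
  proof -
    let ?HB = "tensor_space K H B" and ?p = "biproduct_proj K H B"
    \<comment> \<open>Only the second tensor factor is affected by \<open>F\<close>, because \<open>\<pi> \<circ> F = \<pi>\<close>.\<close>
    have "coaction B (f b) = sweedler K ?HB (comult A (F (b \<ltimes> \<one>\<^bsub>H\<^esub>)))
        (\<lambda>a1 a2. tens K H B (?p a1) (base_proj a2))"
      by (simp add: coaction_base_proj fc b Fbase)
    also have "\<dots> = sweedler K ?HB (comult A (b \<ltimes> \<one>\<^bsub>H\<^esub>))
        (\<lambda>a1 a2. tens K H B (?p (F a1)) (base_proj (F a2)))"
      by (rule sweedler_comult_End_Hopf[OF hopf], (assumption | rule b rules)+)
    also have "\<dots> = sweedler K ?HB (comult A (b \<ltimes> \<one>\<^bsub>H\<^esub>))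
        (\<lambda>a1 a2. sweedler K ?HB (tens K H B (?p a1) (base_proj a2)) (\<lambda>x b0. tens K H B x (f b0)))"
      by (rule sweedler_cong, (assumption | rule b rules)+, subst sweedler_tens, (assumption | rule rules)+)
         (simp add: base_F proj)
    also have "\<dots> = sweedler K ?HB (sweedler K ?HB (comult A (b \<ltimes> \<one>\<^bsub>H\<^esub>))
        (\<lambda>a1 a2. tens K H B (?p a1) (base_proj a2))) (\<lambda>x b0. tens K H B x (f b0))"
      by (rule sweedler_sweedler[symmetric], (assumption | rule b rules)+)
    finally show ?thesis by (simp add: coaction_base_proj b)
  qed
  have "hopf_map K B B f"
    by (rule B_structure.hopf_mapI[OF flin fone fmult fcounit fcomult])
  then have "f \<in> carrier (End_YD K H B)"
    unfolding End_YD_iff using faction fcoaction by (simp add: f_def)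
  moreover have "biproduct_map K H B f = F"
  proof (rule extensionalityI[of _ "carrier T"])
    show "biproduct_map K H B f \<in> extensional (carrier T)" by (simp add: biproduct_map_def biproduct_simps)
    show "F \<in> extensional (carrier T)" using F by (simp add: biproduct_simps)
    fix t assume t: "t \<in> carrier T"
    show "biproduct_map K H B f t = F t"
      by (rule tensor_ext[OF B.module_axioms H.module_axioms module_T biproduct_map_linear[OF flin] lin _ t])
         (simp add: biproduct_map_pure[OF flin] Fpure)
  qed
  ultimately show ?thesis by blast
qed

lemma biproduct_incl_closed: "biproduct_incl K H B \<in> carrier H \<rightarrow> carrier A"
  by (simp add: biproduct_incl_def biproduct_simps pure_closed)

lemma End_YD_linear: "f \<in> carrier (End_YD K H B) \<Longrightarrow> linear_map K B B f"
  unfolding End_YD_iff using B_structure.hopf_mapD(1) by blast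

text \<open>
  Injectivity holds because \<open>P(F(b \<ltimes> 1))\<close> gives back \<open>f(b)\<close> when \<open>F\<close> is the map belonging to \<open>f\<close>.
\<close>

lemma biproduct_map_iso:
  "biproduct_map K H B \<in> iso (End_YD K H B) (End_Hopf K H A (biproduct_proj K H B) (biproduct_incl K H B))"
proof -
  let ?\<Phi> = "biproduct_map K H B" and ?E = "End_Hopf K H A (biproduct_proj K H B) (biproduct_incl K H B)"
  have "?\<Phi> \<in> hom (End_YD K H B) ?E"
  proof (rule homI)
    fix f g assume fg: "f \<in> carrier (End_YD K H B)" "g \<in> carrier (End_YD K H B)"
    note lin = fg[THEN End_YD_linear]
    have comp: "f \<otimes>\<^bsub>End_YD K H B\<^esub> g = compose (carrier B) f g"
      by (simp add: End_YD_def)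
    have "compose (carrier B) f g \<in> carrier (End_YD K H B)"
      using monoid.m_closed[OF monoid_End_YD fg] by (simp add: comp)
    note lin_fg = End_YD_linear[OF this]
    have "?\<Phi> (compose (carrier B) f g) = compose (carrier A) (?\<Phi> f) (?\<Phi> g)"
    proof (rule extensionalityI[of _ "carrier T"])
      fix t assume t: "t \<in> carrier T"
      have "?\<Phi> (compose (carrier B) f g) t = ?\<Phi> f (?\<Phi> g t)"
        by (rule tensor_ext[OF B.module_axioms H.module_axioms module_T biproduct_map_linear[OF lin_fg]
              linear_map_compose[OF biproduct_map_linear[OF lin(1)] biproduct_map_linear[OF lin(2)]] _ t])
           (simp add: biproduct_map_pure lin lin_fg linear_mapD(1)[OF lin(2)] compose_eq)
      then show "?\<Phi> (compose (carrier B) f g) t = compose (carrier A) (?\<Phi> f) (?\<Phi> g) t"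
        using t by (simp add: compose_def biproduct_simps)
    qed (simp_all add: biproduct_map_def biproduct_simps compose_def)
    then show "?\<Phi> (f \<otimes>\<^bsub>End_YD K H B\<^esub> g) = ?\<Phi> f \<otimes>\<^bsub>?E\<^esub> ?\<Phi> g"
      by (simp add: comp End_Hopf_def)
  qed (rule biproduct_map_End_Hopf)
  moreover have "bij_betw ?\<Phi> (carrier (End_YD K H B)) (carrier ?E)"
    unfolding bij_betw_def
  proof (intro conjI inj_onI equalityI subsetI)
    fix f g assume fg: "f \<in> carrier (End_YD K H B)" "g \<in> carrier (End_YD K H B)" and eq: "?\<Phi> f = ?\<Phi> g"
    note lin = fg[THEN End_YD_linear]
    show "f = g"
    proof (rule extensionalityI[of _ "carrier B"])
      fix b assume b: "b \<in> carrier B"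
      have "base_proj (?\<Phi> f (b \<ltimes> \<one>\<^bsub>H\<^esub>)) = base_proj (?\<Phi> g (b \<ltimes> \<one>\<^bsub>H\<^esub>))" by (simp add: eq)
      then show "f b = g b"
        by (simp add: biproduct_map_pure lin b base_proj_base linear_mapD(1)[OF lin(1)] linear_mapD(1)[OF lin(2)])
    qed (use fg End_YD_iff in blast)+
  qed (use biproduct_map_End_Hopf End_Hopf_induced in blast)+
  ultimately show ?thesis by (simp add: iso_def)
qed

end

theorem theorem2:
  fixes K :: "'k ring" and H :: "('k, 'h) bialg" and B :: "('k, 'h, 'b) yd"
  assumes "field K"
    and "hopf_algebra K H"
    and "yd_hopf_algebra K H B"
  defines "A \<equiv> biproduct K H B"
    and "p \<equiv> biproduct_proj K H B"
    and "j \<equiv> biproduct_incl K H B"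
    and "\<Phi> \<equiv> biproduct_map K H B"
  shows "(\<forall>f\<in>carrier (End_YD K H B). \<forall>b\<in>carrier B. \<forall>h\<in>carrier H.
            \<Phi> f (tens K B H b h) = tens K B H (f b) h) \<and>
         monoid (End_YD K H B) \<and> monoid (End_Hopf K H A p j) \<and>
         \<Phi> \<in> iso (End_YD K H B) (End_Hopf K H A p j) \<and>
         group (Aut_YD K H B) \<and> group (Aut_Hopf K H A p j) \<and>
         \<Phi> \<in> iso (Aut_YD K H B) (Aut_Hopf K H A p j)"
proof -
  interpret yd_hopf_algebra K H B by fact
  have pure: "\<forall>f\<in>carrier (End_YD K H B). \<forall>b\<in>carrier B. \<forall>h\<in>carrier H.
      \<Phi> f (tens K B H b h) = tens K B H (f b) h"
    unfolding \<Phi>_def by (simp add: biproduct_map_pure End_YD_linear)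
  have YD: "monoid (End_YD K H B)" by (rule monoid_End_YD)
  have Hopf: "monoid (End_Hopf K H A p j)"
    unfolding A_def j_def by (rule A_structure.monoid_End_Hopf[OF biproduct_incl_closed])
  have iso: "\<Phi> \<in> iso (End_YD K H B) (End_Hopf K H A p j)"
    unfolding A_def p_def j_def \<Phi>_def by (rule biproduct_map_iso)
  have Aut: "Aut_Hopf K H A p j = units_of (End_Hopf K H A p j)"
    unfolding A_def j_def by (rule A_structure.Aut_Hopf_eq_units[OF biproduct_incl_closed])
  show ?thesis
    unfolding Aut_YD_def Aut
    using pure YD Hopf iso iso_units_of[OF YD Hopf iso] monoid.units_group[OF YD] monoid.units_group[OF Hopf]
    by blast
qed

end
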